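(* Let $\mathcal{A}$ be an additive category and $\Phi\colon\mathcal{A}\to\mathcal{A}$ an automorphism of additive categories. (1) If $\mathcal{A}$ is Noetherian, then $\mathcal{A}_\Phi[t]$, $\mathcal{A}_\Phi[t^{-1}]$ and $\mathcal{A}_\Phi[t,t^{-1}]$ are Noetherian. (2) If $\mathcal{A}_\Phi[t]$ is Noetherian, then $\mathcal{A}_\Phi[t,t^{-1}]$ is Noetherian.
   Context: $\mathcal{A}_\Phi[t,t^{-1}]$ has the objects of $\mathcal{A}$; morphisms $A\to B$ are finite formal sums $\sum_{i\in\mathbb{Z}}f_it^i$ with $f_i\colon\Phi^i(A)\to B$ in $\mathcal{A}$, with composition $(\sum_jg_jt^j)\circ(\sum_if_it^i)=\sum_k(\sum_{i+j=k}g_j\circ\Phi^j(f_i))t^k$. $\mathcal{A}_\Phi[t]$ and $\mathcal{A}_\Phi[t^{-1}]$ are the subcategories with the same objects whose morphisms satisfy $f_i=0$ for $i<0$, respectively $f_i=0$ for $i>0$. For an additive category $\mathcal{B}$, a $\mathbb{Z}\mathcal{B}$-module is an additive contravariant functor $\mathcal{B}\to$ abelian groups, finitely generated if a quotient of a finite direct sum of representables $\mathrm{mor}_{\mathcal{B}}(?,B)$; $\mathcal{B}$ is Noetherian if every submodule of a finitely generated $\mathbb{Z}\mathcal{B}$-module is finitely generated. *)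

theory Defs
  imports "HOL-Algebra.FiniteProduct"
begin

text \<open>An (additive) category with object type 'o and morphism type 'f.
  Hom-sets are given explicitly; composition, addition and zero are indexed by
  the objects involved.  ac_comp A B C g f is g composed with f for f : A -> B,
  g : B -> C.\<close>

record ('o, 'f) addcat =
  ac_obj  :: "'o set"
  ac_hom  :: "'o \<Rightarrow> 'o \<Rightarrow> 'f set"
  ac_comp :: "'o \<Rightarrow> 'o \<Rightarrow> 'o \<Rightarrow> 'f \<Rightarrow> 'f \<Rightarrow> 'f"
  ac_id   :: "'o \<Rightarrow> 'f"
  ac_add  :: "'o \<Rightarrow> 'o \<Rightarrow> 'f \<Rightarrow> 'f \<Rightarrow> 'f"
  ac_zero :: "'o \<Rightarrow> 'o \<Rightarrow> 'f"

definition hom_grp :: "('o, 'f) addcat \<Rightarrow> 'o \<Rightarrow> 'o \<Rightarrow> 'f monoid" where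
  "hom_grp C A B = \<lparr>carrier = ac_hom C A B, mult = ac_add C A B, one = ac_zero C A B\<rparr>"

definition is_category :: "('o, 'f) addcat \<Rightarrow> bool" where
  "is_category C \<longleftrightarrow>
     (\<forall>A\<in>ac_obj C. \<forall>B\<in>ac_obj C. \<forall>D\<in>ac_obj C. \<forall>f\<in>ac_hom C A B. \<forall>g\<in>ac_hom C B D.
        ac_comp C A B D g f \<in> ac_hom C A D) \<and>
     (\<forall>A\<in>ac_obj C. ac_id C A \<in> ac_hom C A A) \<and>
     (\<forall>A\<in>ac_obj C. \<forall>B\<in>ac_obj C. \<forall>f\<in>ac_hom C A B.
        ac_comp C A B B (ac_id C B) f = f \<and> ac_comp C A A B f (ac_id C A) = f) \<and>
     (\<forall>A\<in>ac_obj C. \<forall>B\<in>ac_obj C. \<forall>D\<in>ac_obj C. \<forall>E\<in>ac_obj C.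
        \<forall>f\<in>ac_hom C A B. \<forall>g\<in>ac_hom C B D. \<forall>h\<in>ac_hom C D E.
        ac_comp C A D E h (ac_comp C A B D g f) = ac_comp C A B E (ac_comp C B D E h g) f)"

definition is_preadditive :: "('o, 'f) addcat \<Rightarrow> bool" where
  "is_preadditive C \<longleftrightarrow> is_category C \<and>
     (\<forall>A\<in>ac_obj C. \<forall>B\<in>ac_obj C. comm_group (hom_grp C A B)) \<and>
     (\<forall>A\<in>ac_obj C. \<forall>B\<in>ac_obj C. \<forall>D\<in>ac_obj C.
        \<forall>f\<in>ac_hom C A B. \<forall>f'\<in>ac_hom C A B. \<forall>g\<in>ac_hom C B D. \<forall>g'\<in>ac_hom C B D.
        ac_comp C A B D (ac_add C B D g g') f
          = ac_add C A D (ac_comp C A B D g f) (ac_comp C A B D g' f) \<and>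
        ac_comp C A B D g (ac_add C A B f f')
          = ac_add C A D (ac_comp C A B D g f) (ac_comp C A B D g f'))"

definition additive_category :: "('o, 'f) addcat \<Rightarrow> bool" where
  "additive_category C \<longleftrightarrow> is_preadditive C \<and>
     (\<exists>Z\<in>ac_obj C. \<forall>A\<in>ac_obj C. ac_hom C A Z = {ac_zero C A Z} \<and> ac_hom C Z A = {ac_zero C Z A}) \<and>
     (\<forall>A\<in>ac_obj C. \<forall>B\<in>ac_obj C. \<exists>S\<in>ac_obj C.
        \<exists>i1\<in>ac_hom C A S. \<exists>i2\<in>ac_hom C B S. \<exists>p1\<in>ac_hom C S A. \<exists>p2\<in>ac_hom C S B.
          ac_comp C A S A p1 i1 = ac_id C A \<and> ac_comp C B S B p2 i2 = ac_id C B \<and>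
          ac_comp C B S A p1 i2 = ac_zero C B A \<and> ac_comp C A S B p2 i1 = ac_zero C A B \<and>
          ac_add C S S (ac_comp C S A S i1 p1) (ac_comp C S B S i2 p2) = ac_id C S)"

definition additive_automorphism ::
  "('o, 'f) addcat \<Rightarrow> ('o \<Rightarrow> 'o) \<Rightarrow> ('o \<Rightarrow> 'o \<Rightarrow> 'f \<Rightarrow> 'f) \<Rightarrow> bool" where
  "additive_automorphism C po pm \<longleftrightarrow>
     bij_betw po (ac_obj C) (ac_obj C) \<and>
     (\<forall>A\<in>ac_obj C. \<forall>B\<in>ac_obj C. bij_betw (pm A B) (ac_hom C A B) (ac_hom C (po A) (po B))) \<and>
     (\<forall>A\<in>ac_obj C. pm A A (ac_id C A) = ac_id C (po A)) \<and>
     (\<forall>A\<in>ac_obj C. \<forall>B\<in>ac_obj C. \<forall>D\<in>ac_obj C. \<forall>f\<in>ac_hom C A B. \<forall>g\<in>ac_hom C B D.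
        pm A D (ac_comp C A B D g f) = ac_comp C (po A) (po B) (po D) (pm B D g) (pm A B f)) \<and>
     (\<forall>A\<in>ac_obj C. \<forall>B\<in>ac_obj C. \<forall>f\<in>ac_hom C A B. \<forall>g\<in>ac_hom C A B.
        pm A B (ac_add C A B f g) = ac_add C (po A) (po B) (pm A B f) (pm A B g))"

definition inv_obj :: "('o, 'f) addcat \<Rightarrow> ('o \<Rightarrow> 'o) \<Rightarrow> 'o \<Rightarrow> 'o" where
  "inv_obj C po = inv_into (ac_obj C) po"

definition inv_mor :: "('o, 'f) addcat \<Rightarrow> ('o \<Rightarrow> 'o) \<Rightarrow> ('o \<Rightarrow> 'o \<Rightarrow> 'f \<Rightarrow> 'f) \<Rightarrow> 'o \<Rightarrow> 'o \<Rightarrow> 'f \<Rightarrow> 'f" where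
  "inv_mor C po pm A B g =
     inv_into (ac_hom C (inv_obj C po A) (inv_obj C po B)) (pm (inv_obj C po A) (inv_obj C po B)) g"

fun iter_mor :: "('o \<Rightarrow> 'o) \<Rightarrow> ('o \<Rightarrow> 'o \<Rightarrow> 'f \<Rightarrow> 'f) \<Rightarrow> nat \<Rightarrow> 'o \<Rightarrow> 'o \<Rightarrow> 'f \<Rightarrow> 'f" where
  "iter_mor qo qm 0 A B f = f"
| "iter_mor qo qm (Suc n) A B f = qm ((qo ^^ n) A) ((qo ^^ n) B) (iter_mor qo qm n A B f)"

definition pow_obj :: "('o, 'f) addcat \<Rightarrow> ('o \<Rightarrow> 'o) \<Rightarrow> int \<Rightarrow> 'o \<Rightarrow> 'o" where
  "pow_obj C po i A = (if 0 \<le> i then (po ^^ nat i) A else (inv_obj C po ^^ nat (- i)) A)"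

definition pow_mor ::
  "('o, 'f) addcat \<Rightarrow> ('o \<Rightarrow> 'o) \<Rightarrow> ('o \<Rightarrow> 'o \<Rightarrow> 'f \<Rightarrow> 'f) \<Rightarrow> int \<Rightarrow> 'o \<Rightarrow> 'o \<Rightarrow> 'f \<Rightarrow> 'f" where
  "pow_mor C po pm i A B f =
     (if 0 \<le> i then iter_mor po pm (nat i) A B f
      else iter_mor (inv_obj C po) (inv_mor C po pm) (nat (- i)) A B f)"

text \<open>twisted C po pm P: morphisms A -> B are finite formal sums sum_i f_i t^i with
  f_i : Phi^i A -> B and f_i = 0 unless P i.  A formal sum is represented by the
  function i |-> f_i (equal to the zero morphism off its finite support).
  P = (\<lambda>_. True) gives A_Phi[t,t^-1], P = (\<lambda>i. 0 \<le> i) gives A_Phi[t],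
  P = (\<lambda>i. i \<le> 0) gives A_Phi[t^-1].\<close>

definition tw_support :: "('o, 'f) addcat \<Rightarrow> ('o \<Rightarrow> 'o) \<Rightarrow> 'o \<Rightarrow> 'o \<Rightarrow> (int \<Rightarrow> 'f) \<Rightarrow> int set" where
  "tw_support C po A B f = {i. f i \<noteq> ac_zero C (pow_obj C po i A) B}"

definition twisted ::
  "('o, 'f) addcat \<Rightarrow> ('o \<Rightarrow> 'o) \<Rightarrow> ('o \<Rightarrow> 'o \<Rightarrow> 'f \<Rightarrow> 'f) \<Rightarrow> (int \<Rightarrow> bool) \<Rightarrow> ('o, int \<Rightarrow> 'f) addcat" where
  "twisted C po pm P = \<lparr>
     ac_obj = ac_obj C,
     ac_hom = (\<lambda>A B. {f. (\<forall>i. f i \<in> ac_hom C (pow_obj C po i A) B) \<and>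
                         finite (tw_support C po A B f) \<and>
                         (\<forall>i. \<not> P i \<longrightarrow> f i = ac_zero C (pow_obj C po i A) B)}),
     ac_comp = (\<lambda>A B D g f. \<lambda>k.
        finprod (hom_grp C (pow_obj C po k A) D)
          (\<lambda>i. ac_comp C (pow_obj C po k A) (pow_obj C po (k - i) B) D
                 (g (k - i)) (pow_mor C po pm (k - i) (pow_obj C po i A) B (f i)))
          (tw_support C po A B f)),
     ac_id = (\<lambda>A. \<lambda>i. if i = 0 then ac_id C A else ac_zero C (pow_obj C po i A) A),
     ac_add = (\<lambda>A B f g. \<lambda>i. ac_add C (pow_obj C po i A) B (f i) (g i)),
     ac_zero = (\<lambda>A B. \<lambda>i. ac_zero C (pow_obj C po i A) B) \<rparr>"

text \<open>A ZB-module M (additive contravariant functor to abelian groups): carriers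
  mcar M A, group structure at each object, and action mact M A B f : M(B) -> M(A)
  for f : A -> B.\<close>

record ('o, 'f, 'm) cmod =
  mcar  :: "'o \<Rightarrow> 'm set"
  madd  :: "'o \<Rightarrow> 'm \<Rightarrow> 'm \<Rightarrow> 'm"
  mzero :: "'o \<Rightarrow> 'm"
  mact  :: "'o \<Rightarrow> 'o \<Rightarrow> 'f \<Rightarrow> 'm \<Rightarrow> 'm"

definition mod_grp :: "('o, 'f, 'm) cmod \<Rightarrow> 'o \<Rightarrow> 'm monoid" where
  "mod_grp M A = \<lparr>carrier = mcar M A, mult = madd M A, one = mzero M A\<rparr>"

definition is_module :: "('o, 'f) addcat \<Rightarrow> ('o, 'f, 'm) cmod \<Rightarrow> bool" where
  "is_module C M \<longleftrightarrow>
     (\<forall>A\<in>ac_obj C. comm_group (mod_grp M A)) \<and>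
     (\<forall>A\<in>ac_obj C. \<forall>B\<in>ac_obj C. \<forall>f\<in>ac_hom C A B. \<forall>x\<in>mcar M B.
        mact M A B f x \<in> mcar M A) \<and>
     (\<forall>A\<in>ac_obj C. \<forall>B\<in>ac_obj C. \<forall>f\<in>ac_hom C A B. \<forall>x\<in>mcar M B. \<forall>y\<in>mcar M B.
        mact M A B f (madd M B x y) = madd M A (mact M A B f x) (mact M A B f y)) \<and>
     (\<forall>A\<in>ac_obj C. \<forall>B\<in>ac_obj C. \<forall>f\<in>ac_hom C A B. \<forall>g\<in>ac_hom C A B. \<forall>x\<in>mcar M B.
        mact M A B (ac_add C A B f g) x = madd M A (mact M A B f x) (mact M A B g x)) \<and>
     (\<forall>A\<in>ac_obj C. \<forall>x\<in>mcar M A. mact M A A (ac_id C A) x = x) \<and>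
     (\<forall>A\<in>ac_obj C. \<forall>B\<in>ac_obj C. \<forall>D\<in>ac_obj C. \<forall>f\<in>ac_hom C A B. \<forall>g\<in>ac_hom C B D.
        \<forall>x\<in>mcar M D. mact M A D (ac_comp C A B D g f) x = mact M A B f (mact M B D g x))"

text \<open>The finite direct sum of representables mor(?,B_1) + ... + mor(?,B_n), evaluated at A,
  as lists of morphisms.\<close>

definition rep_sum :: "('o, 'f) addcat \<Rightarrow> 'o list \<Rightarrow> 'o \<Rightarrow> 'f list set" where
  "rep_sum C Bs A = {fs. length fs = length Bs \<and> (\<forall>i<length Bs. fs ! i \<in> ac_hom C A (Bs ! i))}"

definition fin_gen :: "('o, 'f) addcat \<Rightarrow> ('o, 'f, 'm) cmod \<Rightarrow> bool" where
  "fin_gen C M \<longleftrightarrow> (\<exists>Bs :: 'o list. \<exists>eta :: 'o \<Rightarrow> 'f list \<Rightarrow> 'm.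
     set Bs \<subseteq> ac_obj C \<and>
     (\<forall>A\<in>ac_obj C. \<forall>fs\<in>rep_sum C Bs A. eta A fs \<in> mcar M A) \<and>
     (\<forall>A\<in>ac_obj C. \<forall>fs\<in>rep_sum C Bs A. \<forall>gs\<in>rep_sum C Bs A.
        eta A (map (\<lambda>i. ac_add C A (Bs ! i) (fs ! i) (gs ! i)) [0..<length Bs])
          = madd M A (eta A fs) (eta A gs)) \<and>
     (\<forall>A\<in>ac_obj C. \<forall>A'\<in>ac_obj C. \<forall>h\<in>ac_hom C A' A. \<forall>fs\<in>rep_sum C Bs A.
        eta A' (map (\<lambda>i. ac_comp C A' A (Bs ! i) (fs ! i) h) [0..<length Bs])
          = mact M A' A h (eta A fs)) \<and>
     (\<forall>A\<in>ac_obj C. mcar M A \<subseteq> eta A ` rep_sum C Bs A))"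

definition submodule :: "('o, 'f) addcat \<Rightarrow> ('o, 'f, 'm) cmod \<Rightarrow> ('o \<Rightarrow> 'm set) \<Rightarrow> bool" where
  "submodule C M N \<longleftrightarrow>
     (\<forall>A\<in>ac_obj C. subgroup (N A) (mod_grp M A)) \<and>
     (\<forall>A\<in>ac_obj C. \<forall>B\<in>ac_obj C. \<forall>f\<in>ac_hom C A B. \<forall>x\<in>N B. mact M A B f x \<in> N A)"

definition noetherian :: "('o, 'f) addcat \<Rightarrow> 'm itself \<Rightarrow> bool" where
  "noetherian C (_ :: 'm itself) \<longleftrightarrow>
     (\<forall>M :: ('o, 'f, 'm) cmod. is_module C M \<and> fin_gen C M \<longrightarrow>
        (\<forall>N. submodule C M N \<longrightarrow> fin_gen C (M\<lparr>mcar := N\<rparr>)))"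

end

theory Submission
  imports Defs
begin

text \<open>Noetherianity is first reduced to right ideals, that is, to submodules of the representable
  modules: a submodule of a module generated by \<open>x\<^sub>1, \<dots>, x\<^sub>n\<close> is controlled, one generator at a time,
  by the right ideal of coefficients of \<open>x\<^sub>k\<close> in elements of the submodule.

  For right ideals Hilbert's argument applies. The leading coefficients in degree \<open>n\<close> of a right ideal
  of \<open>\<A>\<^sub>\<Phi>[t]\<close> on \<open>B\<close> form a right ideal of \<open>\<A>\<close> on \<open>B\<close>, its value at \<open>X\<close> coming from the morphisms
  out of \<open>\<Phi>\<^sup>-\<^sup>n X\<close>. Multiplication by \<open>t\<close> makes these ideals an ascending chain in \<open>n\<close>, so the chain
  stabilises, and two nested right ideals with the same leading coefficients in every degree agree.
  A right ideal of \<open>\<A>\<^sub>\<Phi>[t,t\<^sup>-\<^sup>1]\<close> is generated by its intersection with \<open>\<A>\<^sub>\<Phi>[t]\<close>, since a power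
  of \<open>t\<close> clears denominators.\<close>

section \<open>Modules and right ideals\<close>

text \<open>\<open>noetherian\<close> speaks of modules whose elements have one fixed type, and the
  type in the conclusion is unrelated to the one in the hypothesis. Right ideals consist of
  morphisms, so \<open>right_noetherian\<close> carries no such type; all passages between
  categories are made at that level, and module types enter only at the two ends. Leading
  coefficients live over a moving source: the coefficient at \<open>t^n\<close> of
  \<open>f : A -> B\<close> is a morphism \<open>\<Phi>^n A -> B\<close>. Fixing
  \<open>X = \<Phi>^n A\<close> instead of \<open>A\<close> puts the coefficients of all degrees
  among the morphisms \<open>X -> B\<close>, and only then can degrees be compared. Multiplication
  by \<open>t\<close> on the right respects this: \<Phi> is applied to the right-hand factor, here
  to an identity, so leading coefficients pass to the next degree untwisted. Generation is tested
  against arbitrary submodules \<open>T\<close> containing the generators. Comparison arguments need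
  a submodule of the ideal under study, hence the recurring replacement of \<open>T\<close> by its
  intersection with that ideal.\<close>

lemma explicit_comm_group:
  assumes "comm_group \<lparr>carrier = S, mult = p, one = z\<rparr>" (is "comm_group ?G")
  shows "x \<in> S \<Longrightarrow> y \<in> S \<Longrightarrow> p x y \<in> S"
    and "z \<in> S"
    and "x \<in> S \<Longrightarrow> p z x = x"
    and "x \<in> S \<Longrightarrow> p x z = x"
    and "x \<in> S \<Longrightarrow> y \<in> S \<Longrightarrow> p x y = p y x"
    and "x \<in> S \<Longrightarrow> y \<in> S \<Longrightarrow> w \<in> S \<Longrightarrow> p (p x y) w = p x (p y w)"
    and "x \<in> S \<Longrightarrow> y \<in> S \<Longrightarrow> w \<in> S \<Longrightarrow> p x y = p x w \<longleftrightarrow> y = w"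
    and "x \<in> S \<Longrightarrow> y \<in> S \<Longrightarrow> w \<in> S \<Longrightarrow> p y x = p w x \<longleftrightarrow> y = w"
proof -
  interpret comm_group ?G by fact
  show "x \<in> S \<Longrightarrow> y \<in> S \<Longrightarrow> p x y \<in> S" using m_closed[of x y] by simp
  show "z \<in> S" using one_closed by simp
  show "x \<in> S \<Longrightarrow> p z x = x" using l_one[of x] by simp
  show "x \<in> S \<Longrightarrow> p x z = x" using r_one[of x] by simp
  show "x \<in> S \<Longrightarrow> y \<in> S \<Longrightarrow> p x y = p y x" using m_comm[of x y] by simp
  show "x \<in> S \<Longrightarrow> y \<in> S \<Longrightarrow> w \<in> S \<Longrightarrow> p (p x y) w = p x (p y w)"
    using m_assoc[of x y w] by simp
  show "x \<in> S \<Longrightarrow> y \<in> S \<Longrightarrow> w \<in> S \<Longrightarrow> p x y = p x w \<longleftrightarrow> y = w"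
    using Units_l_cancel[of x y w] by simp
  show "x \<in> S \<Longrightarrow> y \<in> S \<Longrightarrow> w \<in> S \<Longrightarrow> p y x = p w x \<longleftrightarrow> y = w"
    using right_cancel[of x y w] by simp
qed

section \<open>Preadditive categories and tuples of morphisms\<close>

locale preadditive =
  fixes C :: "('o, 'f) addcat"
  assumes preadditive: "is_preadditive C"
begin

lemma hom_comm_group: "A \<in> ac_obj C \<Longrightarrow> B \<in> ac_obj C \<Longrightarrow> comm_group (hom_grp C A B)"
  using preadditive by (simp add: is_preadditive_def)

lemmas hom_group = explicit_comm_group[OF hom_comm_group[unfolded hom_grp_def]]

lemmas add_closed [simp, intro] = hom_group(1)
lemmas zero_closed [simp, intro] = hom_group(2)
lemmas add_zero [simp] = hom_group(3,4)

lemma comp_closed [simp, intro]: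
  "\<lbrakk>A \<in> ac_obj C; B \<in> ac_obj C; D \<in> ac_obj C; f \<in> ac_hom C A B; g \<in> ac_hom C B D\<rbrakk>
    \<Longrightarrow> ac_comp C A B D g f \<in> ac_hom C A D"
  using preadditive by (auto simp: is_preadditive_def is_category_def)

lemma id_closed [simp, intro]: "A \<in> ac_obj C \<Longrightarrow> ac_id C A \<in> ac_hom C A A"
  using preadditive by (auto simp: is_preadditive_def is_category_def)

lemma comp_id [simp]:
  assumes "A \<in> ac_obj C" "B \<in> ac_obj C" "f \<in> ac_hom C A B"
  shows "ac_comp C A B B (ac_id C B) f = f" "ac_comp C A A B f (ac_id C A) = f"
  using preadditive assms by (auto simp: is_preadditive_def is_category_def)

lemma comp_assoc:
  "\<lbrakk>A \<in> ac_obj C; B \<in> ac_obj C; D \<in> ac_obj C; E \<in> ac_obj C;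
    f \<in> ac_hom C A B; g \<in> ac_hom C B D; h \<in> ac_hom C D E\<rbrakk>
    \<Longrightarrow> ac_comp C A D E h (ac_comp C A B D g f) = ac_comp C A B E (ac_comp C B D E h g) f"
  using preadditive unfolding is_preadditive_def is_category_def by blast

lemma comp_add:
  assumes "A \<in> ac_obj C" "B \<in> ac_obj C" "D \<in> ac_obj C"
    "f \<in> ac_hom C A B" "g \<in> ac_hom C B D"
  shows "g' \<in> ac_hom C B D \<Longrightarrow> ac_comp C A B D (ac_add C B D g g') f
          = ac_add C A D (ac_comp C A B D g f) (ac_comp C A B D g' f)"
    and "f' \<in> ac_hom C A B \<Longrightarrow> ac_comp C A B D g (ac_add C A B f f')
          = ac_add C A D (ac_comp C A B D g f) (ac_comp C A B D g f')"
  using preadditive assms unfolding is_preadditive_def by blast+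

lemma comp_zero [simp]:
  assumes [simp]: "A \<in> ac_obj C" "B \<in> ac_obj C" "D \<in> ac_obj C"
  shows "f \<in> ac_hom C A B \<Longrightarrow> ac_comp C A B D (ac_zero C B D) f = ac_zero C A D"
    and "g \<in> ac_hom C B D \<Longrightarrow> ac_comp C A B D g (ac_zero C A B) = ac_zero C A D"
proof -
  assume f: "f \<in> ac_hom C A B"
  let ?x = "ac_comp C A B D (ac_zero C B D) f"
  have "ac_add C A D ?x ?x = ac_add C A D ?x (ac_zero C A D)"
    using f by (simp flip: comp_add(1))
  then show "?x = ac_zero C A D"
    using f by (subst (asm) hom_group(7)) auto
next
  assume g: "g \<in> ac_hom C B D"
  let ?x = "ac_comp C A B D g (ac_zero C A B)"
  have "ac_add C A D ?x ?x = ac_add C A D ?x (ac_zero C A D)"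
    using g by (simp flip: comp_add(2))
  then show "?x = ac_zero C A D"
    using g by (subst (asm) hom_group(7)) auto
qed

text \<open>The records carry no negation; composing or acting with the negative of an identity
  takes its place.\<close>

lemma neg_id_exists:
  assumes "A \<in> ac_obj C"
  obtains u where "u \<in> ac_hom C A A" "ac_add C A A u (ac_id C A) = ac_zero C A A"
proof -
  interpret comm_group "hom_grp C A A" using assms by (rule hom_comm_group[OF _ assms])
  have "ac_id C A \<in> carrier (hom_grp C A A)" using assms by (simp add: hom_grp_def)
  from inv_closed[OF this] l_inv[OF this] show ?thesis
    using that by (simp add: hom_grp_def)
qed

lemma rep_sum_Nil [simp]: "rep_sum C [] A = {[]}"
  by (auto simp: rep_sum_def)

lemma Cons_in_rep_sum [simp]:
  "f # fs \<in> rep_sum C (B # Bs) A \<longleftrightarrow> f \<in> ac_hom C A B \<and> fs \<in> rep_sum C Bs A"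
  by (auto simp: rep_sum_def less_Suc_eq_0_disj)

lemma in_rep_sum_ConsE:
  assumes "fs \<in> rep_sum C (B # Bs) A"
  obtains g gs where "fs = g # gs" "g \<in> ac_hom C A B" "gs \<in> rep_sum C Bs A"
proof -
  obtain g gs where "fs = g # gs"
    using assms by (cases fs) (auto simp: rep_sum_def)
  then show ?thesis using assms that by simp
qed

lemma zeros_in_rep_sum:
  "A \<in> ac_obj C \<Longrightarrow> set Bs \<subseteq> ac_obj C \<Longrightarrow> map (ac_zero C A) Bs \<in> rep_sum C Bs A"
  by (auto simp: rep_sum_def nth_mem subset_iff)

end

section \<open>Representable modules and finitely generated submodules\<close>

definition hom_module :: "('o, 'f) addcat \<Rightarrow> 'o \<Rightarrow> ('o, 'f, 'f) cmod" where
  "hom_module C B = \<lparr>mcar = (\<lambda>A. ac_hom C A B), madd = (\<lambda>A. ac_add C A B),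
     mzero = (\<lambda>A. ac_zero C A B), mact = (\<lambda>A' A h x. ac_comp C A' A B x h)\<rparr>"

lemma hom_module_simps [simp]:
  "mcar (hom_module C B) A = ac_hom C A B"
  "madd (hom_module C B) A = ac_add C A B"
  "mzero (hom_module C B) A = ac_zero C A B"
  "mact (hom_module C B) A' A h x = ac_comp C A' A B x h"
  by (simp_all add: hom_module_def)

text \<open>Finite generation of a submodule, phrased through the submodules containing the generators
  so that no finite sums are involved.\<close>

definition generates ::
  "('o, 'f) addcat \<Rightarrow> ('o, 'f, 'm) cmod \<Rightarrow> ('o \<times> 'm) set \<Rightarrow> ('o \<Rightarrow> 'm set) \<Rightarrow> bool" where
  "generates C M G N \<longleftrightarrow> (\<forall>A x. (A, x) \<in> G \<longrightarrow> A \<in> ac_obj C \<and> x \<in> N A) \<and>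
     (\<forall>T A. submodule C M T \<longrightarrow> (\<forall>B x. (B, x) \<in> G \<longrightarrow> x \<in> T B) \<longrightarrow> A \<in> ac_obj C \<longrightarrow> N A \<subseteq> T A)"

lemma generatesI:
  assumes "\<And>A x. (A, x) \<in> G \<Longrightarrow> A \<in> ac_obj C" "\<And>A x. (A, x) \<in> G \<Longrightarrow> x \<in> N A"
    and "\<And>T A. submodule C M T \<Longrightarrow> (\<And>B x. (B, x) \<in> G \<Longrightarrow> x \<in> T B) \<Longrightarrow> A \<in> ac_obj C \<Longrightarrow> N A \<subseteq> T A"
  shows "generates C M G N"
  unfolding generates_def
proof (intro conjI allI impI)
  fix T A assume "submodule C M T" "\<forall>B x. (B, x) \<in> G \<longrightarrow> x \<in> T B" "A \<in> ac_obj C"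
  then show "N A \<subseteq> T A" by (intro assms(3)) auto
qed (fact assms(1,2))+

lemma generatesD:
  assumes "generates C M G N"
  shows "\<And>A x. (A, x) \<in> G \<Longrightarrow> A \<in> ac_obj C" "\<And>A x. (A, x) \<in> G \<Longrightarrow> x \<in> N A"
    and "\<And>T A. submodule C M T \<Longrightarrow> (\<And>B x. (B, x) \<in> G \<Longrightarrow> x \<in> T B) \<Longrightarrow> A \<in> ac_obj C \<Longrightarrow> N A \<subseteq> T A"
  using assms unfolding generates_def by simp_all

definition fg_submodule :: "('o, 'f) addcat \<Rightarrow> ('o, 'f, 'm) cmod \<Rightarrow> ('o \<Rightarrow> 'm set) \<Rightarrow> bool" where
  "fg_submodule C M N \<longleftrightarrow> (\<exists>G. finite G \<and> generates C M G N)"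

definition right_noetherian :: "('o, 'f) addcat \<Rightarrow> bool" where
  "right_noetherian C \<longleftrightarrow>
     (\<forall>B\<in>ac_obj C. \<forall>S. submodule C (hom_module C B) S \<longrightarrow> fg_submodule C (hom_module C B) S)"

text \<open>The second equation is the empty sum; it also catches lists of unequal length, which
  coefficients taken from \<open>rep_sum\<close> exclude.\<close>

fun lin_comb :: "('o, 'f, 'm) cmod \<Rightarrow> ('o \<times> 'm) list \<Rightarrow> 'o \<Rightarrow> 'f list \<Rightarrow> 'm" where
  "lin_comb M ((B, x) # xs) A (f # fs) = madd M A (mact M A B f x) (lin_comb M xs A fs)"
| "lin_comb M xs A fs = mzero M A"

definition span :: "('o, 'f) addcat \<Rightarrow> ('o, 'f, 'm) cmod \<Rightarrow> ('o \<times> 'm) list \<Rightarrow> 'o \<Rightarrow> 'm set" where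
  "span C M xs A = lin_comb M xs A ` rep_sum C (map fst xs) A"

section \<open>Modules over a preadditive category and their submodules\<close>

locale category_module = preadditive C for C :: "('o, 'f) addcat" +
  fixes M :: "('o, 'f, 'm) cmod"
  assumes module: "is_module C M"
begin

lemma mod_comm_group: "A \<in> ac_obj C \<Longrightarrow> comm_group (mod_grp M A)"
  using module by (simp add: is_module_def)

lemmas mod_group = explicit_comm_group[OF mod_comm_group[unfolded mod_grp_def]]

lemmas madd_closed [simp, intro] = mod_group(1)
lemmas mzero_closed [simp, intro] = mod_group(2)
lemmas madd_zero [simp] = mod_group(3,4)

lemma madd_swap:
  assumes "A \<in> ac_obj C" "x \<in> mcar M A" "y \<in> mcar M A" "z \<in> mcar M A" "w \<in> mcar M A"
  shows "madd M A (madd M A x y) (madd M A z w) = madd M A (madd M A x z) (madd M A y w)"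
proof -
  interpret comm_group "mod_grp M A" using assms by (intro mod_comm_group)
  show ?thesis
    using assms m_assoc[of x y "madd M A z w"] m_lcomm[of y z w] m_assoc[of x z "madd M A y w"]
    by (simp add: mod_grp_def)
qed

lemma mact_closed [simp, intro]:
  "\<lbrakk>A \<in> ac_obj C; B \<in> ac_obj C; f \<in> ac_hom C A B; x \<in> mcar M B\<rbrakk> \<Longrightarrow> mact M A B f x \<in> mcar M A"
  using module by (auto simp: is_module_def)

lemma mact_id [simp]: "A \<in> ac_obj C \<Longrightarrow> x \<in> mcar M A \<Longrightarrow> mact M A A (ac_id C A) x = x"
  using module by (auto simp: is_module_def)

lemma mact_madd:
  "\<lbrakk>A \<in> ac_obj C; B \<in> ac_obj C; f \<in> ac_hom C A B; x \<in> mcar M B; y \<in> mcar M B\<rbrakk>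
    \<Longrightarrow> mact M A B f (madd M B x y) = madd M A (mact M A B f x) (mact M A B f y)"
  using module unfolding is_module_def by blast

lemma mact_add:
  "\<lbrakk>A \<in> ac_obj C; B \<in> ac_obj C; f \<in> ac_hom C A B; g \<in> ac_hom C A B; x \<in> mcar M B\<rbrakk>
    \<Longrightarrow> mact M A B (ac_add C A B f g) x = madd M A (mact M A B f x) (mact M A B g x)"
  using module unfolding is_module_def by blast

lemma mact_comp:
  "\<lbrakk>A \<in> ac_obj C; B \<in> ac_obj C; D \<in> ac_obj C; f \<in> ac_hom C A B; g \<in> ac_hom C B D; x \<in> mcar M D\<rbrakk>
    \<Longrightarrow> mact M A D (ac_comp C A B D g f) x = mact M A B f (mact M B D g x)"
  using module unfolding is_module_def by blast

lemma mact_mzero [simp]: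
  assumes "A \<in> ac_obj C" "B \<in> ac_obj C" "f \<in> ac_hom C A B"
  shows "mact M A B f (mzero M B) = mzero M A"
proof -
  let ?x = "mact M A B f (mzero M B)"
  have "madd M A ?x ?x = madd M A ?x (mzero M A)"
    using assms by (simp flip: mact_madd)
  then show ?thesis using assms by (subst (asm) mod_group(7)) auto
qed

lemma mact_zero [simp]:
  assumes "A \<in> ac_obj C" "B \<in> ac_obj C" "x \<in> mcar M B"
  shows "mact M A B (ac_zero C A B) x = mzero M A"
proof -
  let ?x = "mact M A B (ac_zero C A B) x"
  have "madd M A ?x ?x = madd M A ?x (mzero M A)"
    using assms by (simp flip: mact_add)
  then show ?thesis using assms by (subst (asm) mod_group(7)) auto
qed

lemma mact_neg_id:
  assumes "A \<in> ac_obj C" "u \<in> ac_hom C A A" "ac_add C A A u (ac_id C A) = ac_zero C A A"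
    "x \<in> mcar M A"
  shows "madd M A (mact M A A u x) x = mzero M A"
  using mact_add[of A A u "ac_id C A" x] assms by simp

text \<open>Closure under inverses is automatic, as \<open>- x\<close> is the action of \<open>- id\<close> on \<open>x\<close>.\<close>

lemma submoduleI:
  assumes sub: "\<And>A. A \<in> ac_obj C \<Longrightarrow> N A \<subseteq> mcar M A"
    and zero: "\<And>A. A \<in> ac_obj C \<Longrightarrow> mzero M A \<in> N A"
    and add: "\<And>A x y. A \<in> ac_obj C \<Longrightarrow> x \<in> N A \<Longrightarrow> y \<in> N A \<Longrightarrow> madd M A x y \<in> N A"
    and act: "\<And>A B f x. A \<in> ac_obj C \<Longrightarrow> B \<in> ac_obj C \<Longrightarrow> f \<in> ac_hom C A B \<Longrightarrow> x \<in> N B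
      \<Longrightarrow> mact M A B f x \<in> N A"
  shows "submodule C M N"
  unfolding submodule_def
proof (intro conjI ballI)
  fix A assume A: "A \<in> ac_obj C"
  interpret comm_group "mod_grp M A" using A by (rule mod_comm_group)
  show "subgroup (N A) (mod_grp M A)"
  proof (rule subgroupI)
    fix x assume x: "x \<in> N A"
    obtain u where u: "u \<in> ac_hom C A A" "ac_add C A A u (ac_id C A) = ac_zero C A A"
      using A by (rule neg_id_exists)
    have "inv\<^bsub>mod_grp M A\<^esub> x = mact M A A u x"
      using mact_neg_id[OF A u] x A sub[OF A] u
      by (intro inv_equality) (auto simp: mod_grp_def)
    then show "inv\<^bsub>mod_grp M A\<^esub> x \<in> N A" using act[OF A A u(1) x] by simp
  qed (use sub[OF A] zero[OF A] add[OF A] in \<open>auto simp: mod_grp_def\<close>)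
qed (use act in auto)

lemma submoduleD:
  assumes "submodule C M N" "A \<in> ac_obj C"
  shows "x \<in> N A \<Longrightarrow> x \<in> mcar M A"
    and "mzero M A \<in> N A"
    and "x \<in> N A \<Longrightarrow> y \<in> N A \<Longrightarrow> madd M A x y \<in> N A"
    and "B \<in> ac_obj C \<Longrightarrow> f \<in> ac_hom C A B \<Longrightarrow> z \<in> N B \<Longrightarrow> mact M A B f z \<in> N A"
  using assms unfolding submodule_def subgroup_def mod_grp_def by auto

text \<open>Subtraction, given through the equation that characterises it: \<open>z\<close> is
  \<open>x\<close> plus the action of the negative identity on \<open>y\<close>.\<close>

lemma submodule_diff:
  assumes N: "submodule C M N" "A \<in> ac_obj C" and xy: "x \<in> N A" "y \<in> N A"
  obtains z where "z \<in> N A" "madd M A z y = x"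
proof -
  obtain u where u: "u \<in> ac_hom C A A" "ac_add C A A u (ac_id C A) = ac_zero C A A"
    using N(2) by (rule neg_id_exists)
  have mem: "mact M A A u y \<in> N A" "x \<in> mcar M A" "y \<in> mcar M A" "mact M A A u y \<in> mcar M A"
    using submoduleD[OF N] u N(2) xy by blast+
  have "madd M A (madd M A x (mact M A A u y)) y = x"
    using mem N(2) mact_neg_id[OF N(2) u] by (simp add: mod_group(6))
  then show ?thesis using that submoduleD(3)[OF N xy(1) mem(1)] by blast
qed

lemma submodule_cancel:
  assumes N: "submodule C M N" "A \<in> ac_obj C" and x: "x \<in> mcar M A" "y \<in> N A" "madd M A x y \<in> N A"
  shows "x \<in> N A"
proof -
  obtain z where z: "z \<in> N A" "madd M A z y = madd M A x y"
    using submodule_diff[OF N x(3,2)] by blast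
  then have "z = x"
    using x submoduleD(1)[OF N] N(2) by (subst (asm) mod_group(8)) auto
  then show ?thesis using z by simp
qed

lemma submodule_Int:
  assumes "submodule C M N" "submodule C M N'"
  shows "submodule C M (\<lambda>A. N A \<inter> N' A)"
  by (rule submoduleI) (use submoduleD[OF assms(1)] submoduleD[OF assms(2)] in auto)

lemma submodule_mcar: "submodule C M (mcar M)"
  by (rule submoduleI) auto

section \<open>Spans of finite lists of generators\<close>

definition gens :: "('o \<times> 'm) list \<Rightarrow> bool" where
  "gens xs \<longleftrightarrow> (\<forall>(B, x)\<in>set xs. B \<in> ac_obj C \<and> x \<in> mcar M B)"

lemma gens_simps [simp]:
  "gens []" "gens ((B, x) # xs) \<longleftrightarrow> B \<in> ac_obj C \<and> x \<in> mcar M B \<and> gens xs"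
  by (auto simp: gens_def)

lemma span_Nil [simp]: "span C M [] A = {mzero M A}"
  by (simp add: span_def)

text \<open>This recursion drives the inductions on the list of generators: modulo the span of the
  tail, an element is a multiple of \<open>x\<close>, so a submodule of the span is seen there
  through a right ideal on \<open>B\<close>.\<close>

lemma span_Cons:
  "span C M ((B, x) # xs) A =
    {madd M A (mact M A B f x) y | f y. f \<in> ac_hom C A B \<and> y \<in> span C M xs A}"
proof (intro equalityI subsetI)
  fix z assume "z \<in> span C M ((B, x) # xs) A"
  then obtain fs where "fs \<in> rep_sum C (B # map fst xs) A" "z = lin_comb M ((B, x) # xs) A fs"
    by (auto simp: span_def)
  then show "z \<in> {madd M A (mact M A B f x) y | f y. f \<in> ac_hom C A B \<and> y \<in> span C M xs A}"
    unfolding span_def by (auto elim!: in_rep_sum_ConsE) blast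
next
  fix z assume "z \<in> {madd M A (mact M A B f x) y | f y. f \<in> ac_hom C A B \<and> y \<in> span C M xs A}"
  then obtain f fs where "f \<in> ac_hom C A B" "fs \<in> rep_sum C (map fst xs) A"
    "z = lin_comb M ((B, x) # xs) A (f # fs)"
    by (auto simp: span_def)
  then show "z \<in> span C M ((B, x) # xs) A"
    unfolding span_def by (intro image_eqI[of _ _ "f # fs"]) auto
qed

lemma submodule_span: "gens xs \<Longrightarrow> submodule C M (span C M xs)"
proof (induction xs)
  case Nil
  show ?case by (rule submoduleI) auto
next
  case (Cons a xs)
  obtain B x where a: "a = (B, x)" by (cases a)
  have Bx: "B \<in> ac_obj C" "x \<in> mcar M B" using Cons.prems a by auto
  have IH: "submodule C M (span C M xs)" using Cons a by simp
  note D = submoduleD[OF IH]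
  show ?case unfolding a
  proof (rule submoduleI)
    fix A assume A: "A \<in> ac_obj C"
    show "span C M ((B, x) # xs) A \<subseteq> mcar M A"
      using A Bx D(1) by (auto simp: span_Cons)
    have "mzero M A = madd M A (mact M A B (ac_zero C A B) x) (mzero M A)"
      using A Bx by simp
    then show "mzero M A \<in> span C M ((B, x) # xs) A"
      unfolding span_Cons using A Bx D(2) by blast
    fix y z assume "y \<in> span C M ((B, x) # xs) A" "z \<in> span C M ((B, x) # xs) A"
    then obtain f y' g z' where fy: "f \<in> ac_hom C A B" "y' \<in> span C M xs A"
        "y = madd M A (mact M A B f x) y'"
      and gz: "g \<in> ac_hom C A B" "z' \<in> span C M xs A" "z = madd M A (mact M A B g x) z'"
      unfolding span_Cons by blast
    have "madd M A y z = madd M A (mact M A B (ac_add C A B f g) x) (madd M A y' z')"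
      using fy gz A Bx D(1) by (simp add: mact_add madd_swap)
    then show "madd M A y z \<in> span C M ((B, x) # xs) A"
      unfolding span_Cons using A Bx D(3) fy gz by blast
  next
    fix A A' h y assume A: "A \<in> ac_obj C" "A' \<in> ac_obj C" and h: "h \<in> ac_hom C A A'"
      and "y \<in> span C M ((B, x) # xs) A'"
    then obtain f y' where fy: "f \<in> ac_hom C A' B" "y' \<in> span C M xs A'"
        "y = madd M A' (mact M A' B f x) y'"
      unfolding span_Cons by blast
    have "mact M A A' h y = madd M A (mact M A B (ac_comp C A A' B f h) x) (mact M A A' h y')"
      using fy A h Bx D(1) by (simp add: mact_madd mact_comp)
    then show "mact M A A' h y \<in> span C M ((B, x) # xs) A"
      unfolding span_Cons using A Bx h D(4) fy by blast
  qed
qed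

lemma span_superset:
  assumes "gens xs" "(B, x) \<in> set xs"
  shows "x \<in> span C M xs B"
  using assms
proof (induction xs)
  case (Cons a xs)
  obtain B' x' where a: "a = (B', x')" by (cases a)
  have xs: "submodule C M (span C M xs)" using Cons a by (intro submodule_span) auto
  have B: "B \<in> ac_obj C" "x \<in> mcar M B" using Cons.prems by (auto simp: gens_def)
  show ?case
  proof (cases "a = (B, x)")
    case True
    have "x = madd M B (mact M B B (ac_id C B) x) (mzero M B)" using B by simp
    then show ?thesis
      unfolding True span_Cons using submoduleD(2)[OF xs] B by blast
  next
    case False
    then have "x \<in> span C M xs B" using Cons a by auto
    moreover have "x = madd M B (mact M B B' (ac_zero C B B') x') x"
      using B Cons.prems a by simp
    ultimately show ?thesis
      unfolding a span_Cons using B Cons.prems a by (smt (verit) gens_simps(2) mem_Collect_eq zero_closed)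
  qed
qed auto

lemma span_subset:
  assumes T: "submodule C M T" and "gens xs" "\<And>B x. (B, x) \<in> set xs \<Longrightarrow> x \<in> T B" "A \<in> ac_obj C"
  shows "span C M xs A \<subseteq> T A"
  using assms(2-)
proof (induction xs)
  case Nil
  then show ?case using submoduleD(2)[OF T] by auto
next
  case (Cons a xs)
  then show ?case
    using submoduleD(3,4)[OF T] by (cases a) (auto simp: span_Cons)
qed

text \<open>\<open>generates\<close> bounds \<open>N\<close> by every submodule containing the
  generators, and the span is one of these; conversely \<open>N\<close> itself contains the
  generators, hence their span.\<close>

lemma span_eq_of_fg_submodule:
  assumes "submodule C M N" "fg_submodule C M N"
  obtains xs where "gens xs" "\<forall>A\<in>ac_obj C. span C M xs A = N A"
proof -
  from assms(2) obtain G where gen_G: "finite G" "generates C M G N"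
    unfolding fg_submodule_def by blast
  note G = gen_G(1) generatesD[OF gen_G(2)]
  obtain xs where xs: "set xs = G" using G(1) finite_list by blast
  have gens: "gens xs" using G(2,3) submoduleD(1)[OF assms(1)] by (auto simp: gens_def xs)
  have "N A \<subseteq> span C M xs A" if "A \<in> ac_obj C" for A
    using G(4)[OF submodule_span[OF gens] _ that] span_superset[OF gens] by (auto simp: xs)
  moreover have "span C M xs A \<subseteq> N A" if "A \<in> ac_obj C" for A
    using span_subset[OF assms(1) gens _ that] G(3) xs by blast
  ultimately show ?thesis using that[OF gens] by blast
qed

lemma fg_submodule_of_span:
  assumes "gens xs" "\<And>B x. (B, x) \<in> set xs \<Longrightarrow> x \<in> N B"
    and "\<And>A. A \<in> ac_obj C \<Longrightarrow> N A \<subseteq> span C M xs A"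
  shows "fg_submodule C M N"
unfolding fg_submodule_def
proof (intro exI[of _ "set xs"] conjI generatesI)
  fix T A assume "submodule C M T" "\<And>B x. (B, x) \<in> set xs \<Longrightarrow> x \<in> T B" "A \<in> ac_obj C"
  then show "N A \<subseteq> T A"
    using span_subset[of T xs A] assms by blast
qed (use assms in \<open>auto simp: gens_def\<close>)

section \<open>Finite generation through transformations from sums of representables\<close>

lemma lin_comb_closed:
  assumes "gens xs" "A \<in> ac_obj C" "fs \<in> rep_sum C (map fst xs) A"
  shows "lin_comb M xs A fs \<in> mcar M A"
  using submoduleD(1)[OF submodule_span[OF assms(1)] assms(2)] assms(3) by (auto simp: span_def)

lemma lin_comb_add:
  assumes "gens xs" "A \<in> ac_obj C" "fs \<in> rep_sum C (map fst xs) A" "gs \<in> rep_sum C (map fst xs) A"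
  shows "lin_comb M xs A (map (\<lambda>i. ac_add C A (map fst xs ! i) (fs ! i) (gs ! i)) [0..<length xs])
    = madd M A (lin_comb M xs A fs) (lin_comb M xs A gs)"
  using assms
proof (induction xs arbitrary: fs gs)
  case (Cons a xs)
  obtain B x where a: "a = (B, x)" by (cases a)
  show ?case using Cons a
    by (auto elim!: in_rep_sum_ConsE simp: map_upt_Suc mact_add lin_comb_closed simp del: upt_Suc
       intro!: madd_swap)
qed auto

lemma lin_comb_act:
  assumes "gens xs" "A \<in> ac_obj C" "A' \<in> ac_obj C" "h \<in> ac_hom C A' A"
    "fs \<in> rep_sum C (map fst xs) A"
  shows "lin_comb M xs A' (map (\<lambda>i. ac_comp C A' A (map fst xs ! i) (fs ! i) h) [0..<length xs])
    = mact M A' A h (lin_comb M xs A fs)"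
  using assms
proof (induction xs arbitrary: fs)
  case (Cons a xs)
  obtain B x where a: "a = (B, x)" by (cases a)
  show ?case using Cons a
    by (auto elim!: in_rep_sum_ConsE simp: map_upt_Suc mact_comp mact_madd lin_comb_closed simp del: upt_Suc)
qed auto

text \<open>By the Yoneda lemma a list of elements of \<open>M\<close> over objects \<open>B\<close>
  amounts to a transformation out of the sum of the representables of these objects, namely the
  linear combination map.\<close>

lemma fin_gen_of_fg_submodule:
  assumes "submodule C M N" "fg_submodule C M N"
  shows "fin_gen C (M\<lparr>mcar := N\<rparr>)"
proof -
  obtain xs where xs: "gens xs" "\<forall>A\<in>ac_obj C. span C M xs A = N A"
    using assms by (rule span_eq_of_fg_submodule)
  have "set (map fst xs) \<subseteq> ac_obj C" using xs(1) by (auto simp: gens_def)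
  then show ?thesis
    unfolding fin_gen_def
    using xs lin_comb_add[OF xs(1)] lin_comb_act[OF xs(1)]
    by (intro exI[of _ "map fst xs"] exI[of _ "lin_comb M xs"]) (force simp: span_def)
qed

text \<open>The Yoneda lemma for a finite sum of representables. The generator belonging to a
  summand \<open>B\<close> is the value of \<open>eta\<close> at the tuple with
  \<open>ac_id C B\<close> in that place and zeros elsewhere; additivity separates the summands, and
  naturality recovers each of them from its generator.\<close>

lemma transformation_eq_lin_comb:
  assumes N: "submodule C M N"
    and "set Bs \<subseteq> ac_obj C"
    and "\<And>A fs. A \<in> ac_obj C \<Longrightarrow> fs \<in> rep_sum C Bs A \<Longrightarrow> eta A fs \<in> N A"
    and "\<And>A fs gs. A \<in> ac_obj C \<Longrightarrow> fs \<in> rep_sum C Bs A \<Longrightarrow> gs \<in> rep_sum C Bs A \<Longrightarrow>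
      eta A (map (\<lambda>i. ac_add C A (Bs ! i) (fs ! i) (gs ! i)) [0..<length Bs])
        = madd M A (eta A fs) (eta A gs)"
    and "\<And>A A' h fs. A \<in> ac_obj C \<Longrightarrow> A' \<in> ac_obj C \<Longrightarrow> h \<in> ac_hom C A' A \<Longrightarrow>
      fs \<in> rep_sum C Bs A \<Longrightarrow>
      eta A' (map (\<lambda>i. ac_comp C A' A (Bs ! i) (fs ! i) h) [0..<length Bs]) = mact M A' A h (eta A fs)"
  shows "\<exists>xs. map fst xs = Bs \<and> (\<forall>(B, x)\<in>set xs. x \<in> N B) \<and>
    (\<forall>A\<in>ac_obj C. \<forall>fs\<in>rep_sum C Bs A. eta A fs = lin_comb M xs A fs)"
  using assms(2-)
proof (induction Bs arbitrary: eta)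
  case Nil
  have "eta A [] = mzero M A" if A: "A \<in> ac_obj C" for A
  proof -
    have mem: "eta A [] \<in> mcar M A" using Nil(2)[OF A] submoduleD(1)[OF N A] by simp
    have "madd M A (eta A []) (eta A []) = madd M A (eta A []) (mzero M A)"
      using Nil(3)[OF A, of "[]" "[]"] mem A by simp
    then show ?thesis using mem A by (subst (asm) mod_group(7)) auto
  qed
  then show ?case by simp
next
  case (Cons B Bs)
  have Bs: "B \<in> ac_obj C" "set Bs \<subseteq> ac_obj C" using Cons.prems(1) by auto
  note closed = Cons.prems(2) and add = Cons.prems(3) and nat = Cons.prems(4)
  \<comment> \<open>The restriction of the transformation to the remaining summands.\<close>
  let ?eta = "\<lambda>A fs. eta A (ac_zero C A B # fs)"
  have "\<exists>xs. map fst xs = Bs \<and> (\<forall>(B, x)\<in>set xs. x \<in> N B) \<and>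
    (\<forall>A\<in>ac_obj C. \<forall>fs\<in>rep_sum C Bs A. ?eta A fs = lin_comb M xs A fs)"
  proof (rule Cons.IH)
    show "set Bs \<subseteq> ac_obj C" by fact
    fix A assume A: "A \<in> ac_obj C"
    fix fs assume fs: "fs \<in> rep_sum C Bs A"
    show "?eta A fs \<in> N A" using closed[OF A] fs A Bs by simp
    fix gs assume gs: "gs \<in> rep_sum C Bs A"
    show "?eta A (map (\<lambda>i. ac_add C A (Bs ! i) (fs ! i) (gs ! i)) [0..<length Bs]) =
        madd M A (?eta A fs) (?eta A gs)"
      using add[OF A, of "ac_zero C A B # fs" "ac_zero C A B # gs"] fs gs A Bs
      by (simp add: map_upt_Suc del: upt_Suc)
  next
    fix A A' h fs assume "A \<in> ac_obj C" "A' \<in> ac_obj C" "h \<in> ac_hom C A' A" "fs \<in> rep_sum C Bs A"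
    then show "?eta A' (map (\<lambda>i. ac_comp C A' A (Bs ! i) (fs ! i) h) [0..<length Bs]) =
        mact M A' A h (?eta A fs)"
      using nat[of A A' h "ac_zero C A B # fs"] Bs
      by (simp add: map_upt_Suc del: upt_Suc)
  qed
  then obtain xs where xs: "map fst xs = Bs" "\<forall>(B, x)\<in>set xs. x \<in> N B"
    "\<And>A fs. A \<in> ac_obj C \<Longrightarrow> fs \<in> rep_sum C Bs A \<Longrightarrow> ?eta A fs = lin_comb M xs A fs"
    by blast
  let ?z = "\<lambda>A. map (ac_zero C A) Bs"
  define x where "x = eta B (ac_id C B # ?z B)"
  have z: "?z A \<in> rep_sum C Bs A" if "A \<in> ac_obj C" for A
    using zeros_in_rep_sum that Bs by blast
  have x: "x \<in> N B" unfolding x_def using closed[OF Bs(1)] Bs z by simp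
  have "eta A fs = lin_comb M ((B, x) # xs) A fs"
    if A: "A \<in> ac_obj C" and fs: "fs \<in> rep_sum C (B # Bs) A" for A fs
  proof -
    obtain g gs where g: "fs = g # gs" "g \<in> ac_hom C A B" "gs \<in> rep_sum C Bs A"
      using fs by (rule in_rep_sum_ConsE)
    have len: "length gs = length Bs" using g by (simp add: rep_sum_def)
    have BsO: "Bs ! i \<in> ac_obj C" if "i < length Bs" for i using that Bs by auto
    have gsi: "gs ! i \<in> ac_hom C A (Bs ! i)" if "i < length Bs" for i
      using g(3) that by (simp add: rep_sum_def)
    have 1: "map (\<lambda>i. ac_comp C A B (Bs ! i) (?z B ! i) g) [0..<length Bs] = ?z A"
      by (rule nth_equalityI) (use A Bs g BsO in auto)
    have 2: "map (\<lambda>i. ac_add C A (Bs ! i) (?z A ! i) (gs ! i)) [0..<length Bs] = gs"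
      by (rule nth_equalityI) (use A Bs g gsi BsO len in auto)
    have "mact M A B g x = eta A (g # ?z A)"
      unfolding x_def using nat[OF Bs(1) A g(2), of "ac_id C B # ?z B"] z 1 Bs g A
      by (simp add: map_upt_Suc del: upt_Suc)
    moreover have "madd M A (eta A (g # ?z A)) (?eta A gs) = eta A (g # gs)"
      using add[OF A, of "g # ?z A" "ac_zero C A B # gs"] z[OF A] 2 Bs g A
      by (simp add: map_upt_Suc del: upt_Suc)
    ultimately show ?thesis using g xs(3)[OF A g(3)] by simp
  qed
  then show ?case using xs x by (intro exI[of _ "(B, x) # xs"]) auto
qed

lemma span_of_fin_gen:
  assumes N: "submodule C M N" and "fin_gen C (M\<lparr>mcar := N\<rparr>)"
  obtains xs where "gens xs" "\<And>B x. (B, x) \<in> set xs \<Longrightarrow> x \<in> N B"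
    "\<And>A. A \<in> ac_obj C \<Longrightarrow> N A \<subseteq> span C M xs A"
proof -
  obtain Bs eta where Bs: "set Bs \<subseteq> ac_obj C"
    and closed: "\<forall>A\<in>ac_obj C. \<forall>fs\<in>rep_sum C Bs A. eta A fs \<in> N A"
    and add: "\<forall>A\<in>ac_obj C. \<forall>fs\<in>rep_sum C Bs A. \<forall>gs\<in>rep_sum C Bs A.
        eta A (map (\<lambda>i. ac_add C A (Bs ! i) (fs ! i) (gs ! i)) [0..<length Bs])
          = madd M A (eta A fs) (eta A gs)"
    and nat: "\<forall>A\<in>ac_obj C. \<forall>A'\<in>ac_obj C. \<forall>h\<in>ac_hom C A' A. \<forall>fs\<in>rep_sum C Bs A.
        eta A' (map (\<lambda>i. ac_comp C A' A (Bs ! i) (fs ! i) h) [0..<length Bs])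
          = mact M A' A h (eta A fs)"
    and surj: "\<forall>A\<in>ac_obj C. N A \<subseteq> eta A ` rep_sum C Bs A"
    using assms(2) unfolding fin_gen_def by auto
  obtain xs where xs: "map fst xs = Bs" "\<forall>(B, x)\<in>set xs. x \<in> N B"
    "\<forall>A\<in>ac_obj C. \<forall>fs\<in>rep_sum C Bs A. eta A fs = lin_comb M xs A fs"
    using transformation_eq_lin_comb[OF N Bs, of eta] closed add nat by blast
  have mem: "B \<in> ac_obj C \<and> x \<in> N B" if "(B, x) \<in> set xs" for B x
    using that xs(1,2) Bs by force
  show ?thesis
  proof
    show "gens xs" using mem submoduleD(1)[OF N] by (auto simp: gens_def)
    show "N A \<subseteq> span C M xs A" if "A \<in> ac_obj C" for A
      using surj xs(1,3) that by (force simp: span_def)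
  qed (use mem in blast)
qed

lemma fg_submodule_of_fin_gen:
  "submodule C M N \<Longrightarrow> fin_gen C (M\<lparr>mcar := N\<rparr>) \<Longrightarrow> fg_submodule C M N"
  by (metis span_of_fin_gen fg_submodule_of_span)

section \<open>Coefficient ideals and the reduction to right ideals\<close>

definition coeff_ideal :: "'o \<Rightarrow> 'm \<Rightarrow> ('o \<times> 'm) list \<Rightarrow> ('o \<Rightarrow> 'm set) \<Rightarrow> 'o \<Rightarrow> 'f set" where
  "coeff_ideal B x xs N A =
     {h \<in> ac_hom C A B. \<exists>m\<in>span C M xs A. madd M A (mact M A B h x) m \<in> N A}"

end

lemma (in preadditive) is_module_hom_module:
  "B \<in> ac_obj C \<Longrightarrow> is_module C (hom_module C B)"
  unfolding is_module_def
  using hom_comm_group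
  by (intro conjI ballI) (simp_all add: mod_grp_def hom_grp_def comp_add comp_assoc)

context category_module
begin

text \<open>The ideal is the transporter of \<open>x\<close> into the sum of \<open>N\<close> and
  the span of \<open>xs\<close>; as the span is closed under negation, the sign of the witness
  \<open>m\<close> is immaterial. Witnesses for two coefficients add up to a witness for their sum,
  and acting on a witness gives one for the composite.\<close>

lemma submodule_coeff_ideal:
  assumes B: "B \<in> ac_obj C" "x \<in> mcar M B" and xs: "gens xs" and N: "submodule C M N"
  shows "submodule C (hom_module C B) (coeff_ideal B x xs N)"
proof -
  interpret H: category_module C "hom_module C B"
    by unfold_locales (rule is_module_hom_module[OF B(1)])
  note S = submoduleD[OF submodule_span[OF xs]] and N = submoduleD[OF N]
  show ?thesis
  proof (rule H.submoduleI)
    fix A assume A: "A \<in> ac_obj C"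
    show "coeff_ideal B x xs N A \<subseteq> mcar (hom_module C B) A" by (auto simp: coeff_ideal_def)
    show "mzero (hom_module C B) A \<in> coeff_ideal B x xs N A"
      using A B N(2) S(2) by (auto simp: coeff_ideal_def intro!: bexI[of _ "mzero M A"])
    fix f g assume "f \<in> coeff_ideal B x xs N A" "g \<in> coeff_ideal B x xs N A"
    then obtain m k where f: "f \<in> ac_hom C A B" "m \<in> span C M xs A" "madd M A (mact M A B f x) m \<in> N A"
      and g: "g \<in> ac_hom C A B" "k \<in> span C M xs A" "madd M A (mact M A B g x) k \<in> N A"
      by (auto simp: coeff_ideal_def)
    have "madd M A (mact M A B (ac_add C A B f g) x) (madd M A m k) =
        madd M A (madd M A (mact M A B f x) m) (madd M A (mact M A B g x) k)"
      using f g A B S(1) by (simp add: mact_add madd_swap)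
    then have "madd M A (mact M A B (ac_add C A B f g) x) (madd M A m k) \<in> N A"
      using N(3)[OF A] f g by simp
    then show "madd (hom_module C B) A f g \<in> coeff_ideal B x xs N A"
      using A B f g S(3) by (auto simp: coeff_ideal_def)
  next
    fix A A' h f assume A: "A \<in> ac_obj C" "A' \<in> ac_obj C" and h: "h \<in> ac_hom C A A'"
      and "f \<in> coeff_ideal B x xs N A'"
    then obtain m where f: "f \<in> ac_hom C A' B" "m \<in> span C M xs A'"
        "madd M A' (mact M A' B f x) m \<in> N A'"
      by (auto simp: coeff_ideal_def)
    have "madd M A (mact M A B (ac_comp C A A' B f h) x) (mact M A A' h m) =
        mact M A A' h (madd M A' (mact M A' B f x) m)"
      using f h A B S(1) by (simp add: mact_madd mact_comp)
    then have "madd M A (mact M A B (ac_comp C A A' B f h) x) (mact M A A' h m) \<in> N A"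
      using N(4)[OF A h] f by simp
    then show "mact (hom_module C B) A A' h f \<in> coeff_ideal B x xs N A"
      using A B f h S(4) by (auto simp: coeff_ideal_def)
  qed
qed

text \<open>Finite generation passes through an extension: \<open>N\<close> modulo its intersection
  with the span of the tail is a quotient of the coefficient ideal of the head. Generators of that
  ideal are lifted to \<open>N\<close> and joined with generators of the intersection.\<close>

lemma fg_submodule_of_right_noetherian:
  assumes "right_noetherian C"
  shows "gens xs \<Longrightarrow> submodule C M N \<Longrightarrow> (\<And>A. A \<in> ac_obj C \<Longrightarrow> N A \<subseteq> span C M xs A)
    \<Longrightarrow> fg_submodule C M N"
proof (induction xs arbitrary: N)
  case Nil
  have "N A \<subseteq> T A" if "submodule C M T" "A \<in> ac_obj C" for T A
    using Nil(3)[OF that(2)] submoduleD(2)[OF that] by auto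
  then show ?case by (auto simp: fg_submodule_def intro!: exI[of _ "{}"] generatesI)
next
  case (Cons a xs)
  obtain B x where a: "a = (B, x)" by (cases a)
  have B: "B \<in> ac_obj C" "x \<in> mcar M B" and xs: "gens xs" using Cons.prems a by auto
  note N = Cons.prems(2)
  let ?I = "coeff_ideal B x xs"
  have S: "submodule C M (span C M xs)" using xs by (rule submodule_span)
  have "fg_submodule C (hom_module C B) (?I N)"
    using assms B submodule_coeff_ideal[OF B xs N] unfolding right_noetherian_def by blast
  then obtain G where gen_G: "finite G" "generates C (hom_module C B) G (?I N)"
    unfolding fg_submodule_def by blast
  note G = gen_G(1) generatesD[OF gen_G(2)]
  have "fg_submodule C M (\<lambda>A. N A \<inter> span C M xs A)"
    using Cons.IH[OF xs submodule_Int[OF N S]] by blast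
  then obtain G' where gen_G': "finite G'" "generates C M G' (\<lambda>A. N A \<inter> span C M xs A)"
    unfolding fg_submodule_def by blast
  note G' = gen_G'(1) generatesD[OF gen_G'(2)]
  have "\<exists>m. m \<in> span C M xs A \<and> madd M A (mact M A B h x) m \<in> N A" if "(A, h) \<in> G" for A h
    using G(3)[OF that] by (auto simp: coeff_ideal_def)
  then obtain m where m: "\<And>A h. (A, h) \<in> G \<Longrightarrow> m A h \<in> span C M xs A"
      "\<And>A h. (A, h) \<in> G \<Longrightarrow> madd M A (mact M A B h x) (m A h) \<in> N A"
    by metis
  define lift where "lift = (\<lambda>(A, h). (A, madd M A (mact M A B h x) (m A h)))"
  show ?case
  unfolding fg_submodule_def
proof (intro exI[of _ "lift ` G \<union> G'"] conjI generatesI)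
    show "finite (lift ` G \<union> G')" using G G' by simp
    fix A y assume "(A, y) \<in> lift ` G \<union> G'"
    then show "A \<in> ac_obj C" "y \<in> N A"
      using G(2) G'(2,3) m(2) by (auto simp: lift_def)
  next
    fix T A
    assume T: "submodule C M T" and gens: "\<And>A x. (A, x) \<in> lift ` G \<union> G' \<Longrightarrow> x \<in> T A"
      and A: "A \<in> ac_obj C"
    \<comment> \<open>Membership in \<open>N\<close> is kept along with membership in
      \<open>T\<close>: the difference formed below has to land in \<open>N\<close>, where the
      generators \<open>G'\<close> control it.\<close>
    let ?T = "\<lambda>A. T A \<inter> N A"
    have T': "submodule C M ?T" using submodule_Int[OF T N] .
    have "h \<in> ?I ?T A'" if "(A', h) \<in> G" for A' h
    proof -
      have "(A', madd M A' (mact M A' B h x) (m A' h)) \<in> lift ` G"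
        using that by (force simp: lift_def)
      then have "madd M A' (mact M A' B h x) (m A' h) \<in> ?T A'"
        using gens m(2)[OF that] by blast
      then show ?thesis using G(3)[OF that] m(1)[OF that] by (auto simp: coeff_ideal_def)
    qed
    then have I: "?I N A \<subseteq> ?I ?T A"
      using G(4)[OF submodule_coeff_ideal[OF B xs T'] _ A] by blast
    have S': "N A \<inter> span C M xs A \<subseteq> T A"
      using G'(4)[OF T _ A] gens by blast
    show "N A \<subseteq> T A"
    proof
      fix y assume y: "y \<in> N A"
      obtain h k where h: "h \<in> ac_hom C A B" "k \<in> span C M xs A" "y = madd M A (mact M A B h x) k"
        using Cons.prems(3)[OF A] y unfolding a span_Cons by blast
      then have "h \<in> ?I N A" using y by (auto simp: coeff_ideal_def)
      then obtain k' where k': "k' \<in> span C M xs A" "madd M A (mact M A B h x) k' \<in> ?T A"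
        using I by (auto simp: coeff_ideal_def)
      \<comment> \<open>\<open>k\<close> and \<open>k'\<close> complete the same coefficient
        \<open>h\<close>, the first to an element of \<open>N\<close>, the second to one of both
        \<open>T\<close> and \<open>N\<close>. So their difference lies in \<open>N\<close> and in
        the span of the tail, hence in \<open>T\<close>.\<close>
      obtain d where d: "d \<in> span C M xs A" "madd M A d k' = k"
        using submodule_diff[OF S A h(2) k'(1)] .
      have mem: "d \<in> mcar M A" "k' \<in> mcar M A" "mact M A B h x \<in> mcar M A"
        using submoduleD(1)[OF S A] d k' h A B by auto
      have y_eq: "y = madd M A d (madd M A (mact M A B h x) k')"
        using mem A unfolding h(3) d(2)[symmetric]
        by (metis mod_group(5) mod_group(6))
      have "d \<in> N A" using submodule_cancel[OF N A mem(1)] k'(2) y y_eq by blast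
      then have "d \<in> T A" using S' d by blast
      then show "y \<in> T A" using y_eq k'(2) submoduleD(3)[OF T A] by simp
    qed
  qed
qed

end

text \<open>The type \<open>'m\<close> is arbitrary, since the hypothesis concerns morphisms only.
  The module is treated as a submodule of itself, which yields a finite list spanning it and hence
  containing \<open>N\<close> in its span.\<close>

lemma (in preadditive) noetherian_of_right_noetherian:
  assumes "right_noetherian C"
  shows "noetherian C TYPE('m)"
  unfolding noetherian_def
proof (intro allI impI; elim conjE)
  fix M :: "('o, 'f, 'm) cmod" and N
  assume M: "is_module C M" "fin_gen C M" and N: "submodule C M N"
  interpret category_module C M by unfold_locales fact
  have "fin_gen C (M\<lparr>mcar := mcar M\<rparr>)" using M(2) by simp
  then obtain xs where xs: "gens xs" "\<And>A. A \<in> ac_obj C \<Longrightarrow> mcar M A \<subseteq> span C M xs A"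
    using span_of_fin_gen[OF submodule_mcar] by metis
  have "fg_submodule C M N"
    using submoduleD(1)[OF N] xs(2)
    by (intro fg_submodule_of_right_noetherian[OF assms xs(1) N]) blast
  then show "fin_gen C (M\<lparr>mcar := N\<rparr>)" using N fin_gen_of_fg_submodule by blast
qed

text \<open>The module type \<open>'n\<close> of the hypothesis need only be large enough to receive the
  representable modules, through the injection \<open>e\<close>.\<close>

lemma (in preadditive) right_noetherian_of_noetherian:
  fixes e :: "'f \<Rightarrow> 'n"
  assumes noeth: "noetherian C TYPE('n)" and e: "inj e"
  shows "right_noetherian C"
  unfolding right_noetherian_def
proof (intro ballI allI impI)
  fix B S assume B: "B \<in> ac_obj C" and S: "submodule C (hom_module C B) S"
  interpret H: category_module C "hom_module C B"
    by unfold_locales (rule is_module_hom_module[OF B])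
  define d where "d = inv_into UNIV e"
  have d [simp]: "d (e f) = f" for f using e by (simp add: d_def)
  \<comment> \<open>A copy of the representable module of \<open>B\<close> with its elements renamed
    along \<open>e\<close>; \<open>d\<close> undoes the renaming.\<close>
  define E where "E = \<lparr>mcar = (\<lambda>A. e ` ac_hom C A B),
    madd = (\<lambda>A u v. e (ac_add C A B (d u) (d v))), mzero = (\<lambda>A. e (ac_zero C A B)),
    mact = (\<lambda>A' A h u. e (ac_comp C A' A B (d u) h))\<rparr>"
  have E: "mcar E A = e ` ac_hom C A B" "madd E A (e f) (e g) = e (ac_add C A B f g)"
    "mzero E A = e (ac_zero C A B)" "mact E A' A h (e f) = e (ac_comp C A' A B f h)" for A A' f g h
    by (simp_all add: E_def)
  have group: "comm_group (mod_grp E A)" if A: "A \<in> ac_obj C" for A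
  proof (rule comm_groupI)
    fix u assume "u \<in> carrier (mod_grp E A)"
    then obtain f where f: "u = e f" "f \<in> ac_hom C A B" by (auto simp: mod_grp_def E)
    obtain v where v: "v \<in> ac_hom C A A" "ac_add C A A v (ac_id C A) = ac_zero C A A"
      using A by (rule neg_id_exists)
    have "ac_add C A B (ac_comp C A A B f v) f = ac_zero C A B"
      using H.mact_neg_id[OF A v] f by simp
    then show "\<exists>y\<in>carrier (mod_grp E A). y \<otimes>\<^bsub>mod_grp E A\<^esub> u = \<one>\<^bsub>mod_grp E A\<^esub>"
      using f v A B by (intro bexI[of _ "e (ac_comp C A A B f v)"]) (auto simp: mod_grp_def E)
  qed (use A B hom_group(5)[OF A B] in \<open>auto simp: mod_grp_def E hom_group(6)\<close>)
  have module_E: "is_module C E"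
    unfolding is_module_def using group B
    by (intro conjI ballI) (auto simp: E comp_add comp_assoc)
  interpret E: category_module C E by unfold_locales fact
  \<comment> \<open>The identity of \<open>B\<close> generates, because acting with \<open>f\<close>
    on it gives \<open>f\<close>.\<close>
  have "fg_submodule C E (mcar E)"
  unfolding fg_submodule_def
proof (intro exI[of _ "{(B, e (ac_id C B))}"] conjI generatesI subsetI)
    fix T A u assume T: "submodule C E T" "\<And>A x. (A, x) \<in> {(B, e (ac_id C B))} \<Longrightarrow> x \<in> T A"
      and A: "A \<in> ac_obj C" and "u \<in> mcar E A"
    then obtain f where f: "u = e f" "f \<in> ac_hom C A B" by (auto simp: E)
    have "mact E A B f (e (ac_id C B)) \<in> T A"
      using E.submoduleD(4)[OF T(1) A B f(2)] T(2) by auto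
    then show "u \<in> T A" using f A B by (simp add: E)
  qed (use B in \<open>auto simp: E\<close>)
  then have "fin_gen C E" using E.fin_gen_of_fg_submodule[OF E.submodule_mcar] by simp
  moreover have sub: "submodule C E (\<lambda>A. e ` T A)" if "submodule C (hom_module C B) T" for T
    by (rule E.submoduleI) (use H.submoduleD[OF that] in \<open>auto simp: E\<close>)
  ultimately have "fin_gen C (E\<lparr>mcar := \<lambda>A. e ` S A\<rparr>)"
    using noeth module_E S unfolding noetherian_def by blast
  then have "fg_submodule C E (\<lambda>A. e ` S A)"
    using E.fg_submodule_of_fin_gen sub[OF S] by blast
  then obtain G where gen_G: "finite G" "generates C E G (\<lambda>A. e ` S A)"
    unfolding fg_submodule_def by blast
  note G = gen_G(1) generatesD[OF gen_G(2)]
  \<comment> \<open>Submodules of the representable module are renamed to submodules of the copy, so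
    \<open>d\<close> carries generators of the renamed \<open>S\<close> back to generators of
    \<open>S\<close>.\<close>
  show "fg_submodule C (hom_module C B) S"
  unfolding fg_submodule_def
proof (intro exI[of _ "map_prod id d ` G"] conjI generatesI subsetI)
    fix T A f assume T: "submodule C (hom_module C B) T"
      "\<And>A x. (A, x) \<in> map_prod id d ` G \<Longrightarrow> x \<in> T A" and A: "A \<in> ac_obj C" and f: "f \<in> S A"
    have "u \<in> e ` T A" if u: "(A, u) \<in> G" for A u
    proof -
      obtain g where "u = e g" using G(3)[OF u] by blast
      moreover have "d u \<in> T A" using T(2) u by force
      ultimately show ?thesis by auto
    qed
    then have "e ` S A \<subseteq> e ` T A" using G(4)[OF sub[OF T(1)] _ A] by blast
    then show "f \<in> T A" using f e by (auto dest: injD)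
  qed (use G(1-3) in \<open>force+\<close>)
qed

section \<open>Twisted Laurent polynomial categories\<close>

lemma finprod_hom:
  assumes "comm_group G" "comm_group H" "\<phi> \<in> hom G H" "finite I" "f \<in> I \<rightarrow> carrier G"
  shows "\<phi> (finprod G f I) = finprod H (\<lambda>i. \<phi> (f i)) I"
proof -
  interpret G: comm_group G by fact
  interpret H: comm_group H by fact
  interpret group_hom G H \<phi> by unfold_locales fact
  show ?thesis using assms(4,5)
    by (induction I) (auto simp: Pi_def G.finprod_insert H.finprod_insert)
qed

lemma (in comm_monoid) finprod_swap:
  assumes "finite I" "finite J" "\<And>i j. i \<in> I \<Longrightarrow> j \<in> J \<Longrightarrow> f i j \<in> carrier G"
  shows "finprod G (\<lambda>i. finprod G (f i) J) I = finprod G (\<lambda>j. finprod G (\<lambda>i. f i j) I) J"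
  using assms(1,3)
proof (induction I)
  case (insert x I)
  then have "finprod G (\<lambda>j. finprod G (\<lambda>i. f i j) (insert x I)) J =
      finprod G (\<lambda>j. f x j \<otimes> finprod G (\<lambda>i. f i j) I) J"
    by (intro finprod_cong') (auto simp: Pi_def)
  also have "\<dots> = finprod G (f x) J \<otimes> finprod G (\<lambda>j. finprod G (\<lambda>i. f i j) I) J"
    using insert by (intro finprod_multf) (auto simp: Pi_def)
  finally show ?case using insert by (simp add: Pi_def)
qed simp

text \<open>An equivalence, unlike an implication, propagates from zero in both directions, so a
  single successor step also covers the negative integers.\<close>

lemma int_iff_induct [case_names zero step]:
  fixes R :: "int \<Rightarrow> bool"
  assumes "R 0" "\<And>i. R (i + 1) \<longleftrightarrow> R i"
  shows "R i"
proof (induction i rule: int_induct[of _ 0])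
  case (step2 i)
  then show ?case using assms(2)[of "i - 1"] by simp
qed (use assms in auto)

context preadditive
begin

abbreviation msum :: "'o \<Rightarrow> 'o \<Rightarrow> ('i \<Rightarrow> 'f) \<Rightarrow> 'i set \<Rightarrow> 'f" where
  "msum A B \<equiv> finprod (hom_grp C A B)"

lemma hom_grp_simps [simp]:
  "carrier (hom_grp C A B) = ac_hom C A B"
  "mult (hom_grp C A B) = ac_add C A B"
  "one (hom_grp C A B) = ac_zero C A B"
  by (simp_all add: hom_grp_def)

context
  fixes A B
  assumes AB: "A \<in> ac_obj C" "B \<in> ac_obj C"
begin

interpretation comm_group "hom_grp C A B" using AB by (rule hom_comm_group)

lemma msum_closed: "(\<And>i. i \<in> I \<Longrightarrow> f i \<in> ac_hom C A B) \<Longrightarrow> msum A B f I \<in> ac_hom C A B"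
  using finprod_closed[of f I] by (auto simp: Pi_def)

lemma msum_cong: "(\<And>i. i \<in> I \<Longrightarrow> f i = g i) \<Longrightarrow> (\<And>i. i \<in> I \<Longrightarrow> g i \<in> ac_hom C A B) \<Longrightarrow>
    msum A B f I = msum A B g I"
  by (rule finprod_cong') auto

lemma msum_mono_neutral:
  "finite J \<Longrightarrow> I \<subseteq> J \<Longrightarrow> (\<And>i. i \<in> J - I \<Longrightarrow> f i = ac_zero C A B) \<Longrightarrow>
    (\<And>i. i \<in> J \<Longrightarrow> f i \<in> ac_hom C A B) \<Longrightarrow> msum A B f I = msum A B f J"
  by (rule finprod_mono_neutral_cong_left) auto

lemma msum_zero: "(\<And>i. i \<in> I \<Longrightarrow> f i = ac_zero C A B) \<Longrightarrow> msum A B f I = ac_zero C A B"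
  using finprod_one_eqI[of I f] by auto

lemma msum_sing: "f i \<in> ac_hom C A B \<Longrightarrow> msum A B f {i} = f i"
  using finprod_insert[of "{}" i f] AB by auto

lemma msum_single:
  assumes "finite I" "k \<in> I" "\<And>i. i \<in> I \<Longrightarrow> i \<noteq> k \<Longrightarrow> f i = ac_zero C A B" "f k \<in> ac_hom C A B"
  shows "msum A B f I = f k"
proof -
  have "msum A B f {k} = msum A B f I"
    using assms AB by (intro msum_mono_neutral) (auto, metis zero_closed)
  then show ?thesis using msum_sing[of f k] assms by simp
qed

lemma msum_add:
  "(\<And>i. i \<in> I \<Longrightarrow> f i \<in> ac_hom C A B) \<Longrightarrow> (\<And>i. i \<in> I \<Longrightarrow> g i \<in> ac_hom C A B) \<Longrightarrow>
    msum A B (\<lambda>i. ac_add C A B (f i) (g i)) I = ac_add C A B (msum A B f I) (msum A B g I)"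
  using finprod_multf[of f I g] by (auto simp: Pi_def)

lemma msum_swap:
  "finite I \<Longrightarrow> finite J \<Longrightarrow> (\<And>i j. i \<in> I \<Longrightarrow> j \<in> J \<Longrightarrow> f i j \<in> ac_hom C A B) \<Longrightarrow>
    msum A B (\<lambda>i. msum A B (f i) J) I = msum A B (\<lambda>j. msum A B (\<lambda>i. f i j) I) J"
  by (rule finprod_swap) auto

lemma msum_reindex:
  "inj_on h I \<Longrightarrow> (\<And>i. i \<in> I \<Longrightarrow> f (h i) \<in> ac_hom C A B) \<Longrightarrow>
    msum A B f (h ` I) = msum A B (\<lambda>i. f (h i)) I"
  by (rule finprod_reindex) auto

end

lemma comp_msum_left:
  assumes [simp]: "A \<in> ac_obj C" "B \<in> ac_obj C" "D \<in> ac_obj C" "finite I" "f \<in> ac_hom C A B"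
    and "\<And>i. i \<in> I \<Longrightarrow> g i \<in> ac_hom C B D"
  shows "ac_comp C A B D (msum B D g I) f = msum A D (\<lambda>i. ac_comp C A B D (g i) f) I"
  by (rule finprod_hom[where \<phi> = "\<lambda>x. ac_comp C A B D x f"])
    (use assms in \<open>auto simp: hom_def comp_add intro: hom_comm_group\<close>)

lemma comp_msum_right:
  assumes [simp]: "A \<in> ac_obj C" "B \<in> ac_obj C" "D \<in> ac_obj C" "finite I" "g \<in> ac_hom C B D"
    and "\<And>i. i \<in> I \<Longrightarrow> f i \<in> ac_hom C A B"
  shows "ac_comp C A B D g (msum A B f I) = msum A D (\<lambda>i. ac_comp C A B D g (f i)) I"
  by (rule finprod_hom[where \<phi> = "\<lambda>x. ac_comp C A B D g x"])
    (use assms in \<open>auto simp: hom_def comp_add intro: hom_comm_group\<close>)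

end

lemma tw_simps [simp]:
  "ac_obj (twisted C po pm Q) = ac_obj C"
  "ac_id (twisted C po pm Q) A = (\<lambda>i. if i = 0 then ac_id C A else ac_zero C (pow_obj C po i A) A)"
  "ac_add (twisted C po pm Q) A B f g = (\<lambda>i. ac_add C (pow_obj C po i A) B (f i) (g i))"
  "ac_zero (twisted C po pm Q) A B = (\<lambda>i. ac_zero C (pow_obj C po i A) B)"
  by (simp_all add: twisted_def)

text \<open>The admissible exponents form a submonoid of the integers, which is what identities and
  composites need in order to stay in the subcategory. All integers, the nonnegative ones and the
  nonpositive ones are the instances.\<close>

locale twisted_category = preadditive C for C :: "('o, 'f) addcat" +
  fixes po :: "'o \<Rightarrow> 'o" and pm :: "'o \<Rightarrow> 'o \<Rightarrow> 'f \<Rightarrow> 'f" and Q :: "int \<Rightarrow> bool"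
  assumes aut: "additive_automorphism C po pm"
    and Q_zero: "Q 0" and Q_add: "Q i \<Longrightarrow> Q j \<Longrightarrow> Q (i + j)"
begin

abbreviation (input) P :: "int \<Rightarrow> 'o \<Rightarrow> 'o" where "P \<equiv> pow_obj C po"
abbreviation (input) F :: "int \<Rightarrow> 'o \<Rightarrow> 'o \<Rightarrow> 'f \<Rightarrow> 'f" where "F \<equiv> pow_mor C po pm"
abbreviation (input) qo :: "'o \<Rightarrow> 'o" where "qo \<equiv> inv_obj C po"
abbreviation (input) qm :: "'o \<Rightarrow> 'o \<Rightarrow> 'f \<Rightarrow> 'f" where "qm \<equiv> inv_mor C po pm"
abbreviation (input) D :: "('o, int \<Rightarrow> 'f) addcat" where "D \<equiv> twisted C po pm Q"

section \<open>Integer powers of the automorphism\<close>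

lemma po_bij: "bij_betw po (ac_obj C) (ac_obj C)"
  and pm_bij: "A \<in> ac_obj C \<Longrightarrow> B \<in> ac_obj C \<Longrightarrow>
    bij_betw (pm A B) (ac_hom C A B) (ac_hom C (po A) (po B))"
  and pm_id: "A \<in> ac_obj C \<Longrightarrow> pm A A (ac_id C A) = ac_id C (po A)"
  using aut by (auto simp: additive_automorphism_def)

lemma pm_comp: "\<lbrakk>A \<in> ac_obj C; B \<in> ac_obj C; E \<in> ac_obj C; f \<in> ac_hom C A B; g \<in> ac_hom C B E\<rbrakk>
    \<Longrightarrow> pm A E (ac_comp C A B E g f) = ac_comp C (po A) (po B) (po E) (pm B E g) (pm A B f)"
  using aut by (simp add: additive_automorphism_def)

lemma pm_add: "\<lbrakk>A \<in> ac_obj C; B \<in> ac_obj C; f \<in> ac_hom C A B; g \<in> ac_hom C A B\<rbrakk>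
    \<Longrightarrow> pm A B (ac_add C A B f g) = ac_add C (po A) (po B) (pm A B f) (pm A B g)"
  using aut by (simp add: additive_automorphism_def)

lemma po_closed [simp]: "A \<in> ac_obj C \<Longrightarrow> po A \<in> ac_obj C"
  using po_bij by (auto simp: bij_betw_def)

lemma qo_closed [simp]: "A \<in> ac_obj C \<Longrightarrow> qo A \<in> ac_obj C"
  using bij_betw_inv_into[OF po_bij] by (auto simp: bij_betw_def inv_obj_def)

lemma po_qo [simp]: "A \<in> ac_obj C \<Longrightarrow> po (qo A) = A"
  using po_bij by (simp add: inv_obj_def bij_betw_inv_into_right)

lemma pm_closed: "\<lbrakk>A \<in> ac_obj C; B \<in> ac_obj C; f \<in> ac_hom C A B\<rbrakk> \<Longrightarrow> pm A B f \<in> ac_hom C (po A) (po B)"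
  using pm_bij[of A B] by (auto simp: bij_betw_def)

lemma pm_eq_iff: "\<lbrakk>A \<in> ac_obj C; B \<in> ac_obj C; f \<in> ac_hom C A B; g \<in> ac_hom C A B\<rbrakk>
    \<Longrightarrow> pm A B f = pm A B g \<longleftrightarrow> f = g"
  using pm_bij[of A B] by (auto simp: bij_betw_def dest: inj_onD)

lemma qm_closed:
  assumes "A \<in> ac_obj C" "B \<in> ac_obj C" "f \<in> ac_hom C A B"
  shows "qm A B f \<in> ac_hom C (qo A) (qo B)"
  using bij_betw_inv_into[OF pm_bij, of "qo A" "qo B"] assms
  by (auto simp: bij_betw_def inv_mor_def)

lemma pm_qm:
  assumes "A \<in> ac_obj C" "B \<in> ac_obj C" "f \<in> ac_hom C A B"
  shows "pm (qo A) (qo B) (qm A B f) = f"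
  using bij_betw_inv_into_right[OF pm_bij, of "qo A" "qo B" f] assms
  by (simp add: inv_mor_def)

lemma P_closed [simp]: "A \<in> ac_obj C \<Longrightarrow> P i A \<in> ac_obj C"
proof -
  assume A: "A \<in> ac_obj C"
  have "(po ^^ n) A \<in> ac_obj C" "(qo ^^ n) A \<in> ac_obj C" for n
    using A by (induction n) auto
  then show ?thesis by (simp add: pow_obj_def)
qed

lemma P_zero [simp]: "P 0 A = A" and F_zero [simp]: "F 0 A B f = f"
  by (simp_all add: pow_obj_def pow_mor_def)

text \<open>Powers iterate \<Phi> or its inverse according to the sign of the exponent. In the
  second case the successor step cancels the outermost inverse.\<close>

lemma int_step_cases:
  obtains n where "i = int n" "i + 1 = int (Suc n)" | n where "i = - int (Suc n)" "i + 1 = - int n"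
proof (cases "0 \<le> i")
  case True
  then show ?thesis using that(1)[of "nat i"] by simp
next
  case False
  then show ?thesis using that(2)[of "nat (- i - 1)"] by simp
qed

lemma P_neg: "P (- int n) A = (qo ^^ n) A" and F_neg: "F (- int n) A B f = iter_mor qo qm n A B f"
  by (cases n; simp add: pow_obj_def pow_mor_def nat_add_distrib)+

lemma P_succ: "A \<in> ac_obj C \<Longrightarrow> P (i + 1) A = po (P i A)"
proof (cases i rule: int_step_cases)
  case (1 n)
  then show ?thesis unfolding 1(2) unfolding 1(1) by (simp add: pow_obj_def del: of_nat_Suc)
next
  case (2 n)
  assume "A \<in> ac_obj C"
  then have "(qo ^^ n) A \<in> ac_obj C" by (induction n) auto
  then show ?thesis unfolding 2(2) unfolding 2(1) P_neg by simp
qed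

lemma qo_pow_closed: "A \<in> ac_obj C \<Longrightarrow> (qo ^^ n) A \<in> ac_obj C"
  by (induction n) auto

lemma iter_qm_closed: "\<lbrakk>A \<in> ac_obj C; B \<in> ac_obj C; f \<in> ac_hom C A B\<rbrakk>
    \<Longrightarrow> iter_mor qo qm n A B f \<in> ac_hom C ((qo ^^ n) A) ((qo ^^ n) B)"
  by (induction n) (auto simp: qo_pow_closed qm_closed)

lemma F_succ:
  assumes "A \<in> ac_obj C" "B \<in> ac_obj C" "f \<in> ac_hom C A B"
  shows "F (i + 1) A B f = pm (P i A) (P i B) (F i A B f)"
proof (cases i rule: int_step_cases)
  case (1 n)
  then show ?thesis unfolding 1(2) unfolding 1(1) by (simp add: pow_obj_def pow_mor_def del: of_nat_Suc)
next
  case (2 n)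
  then show ?thesis unfolding 2(2) unfolding 2(1) P_neg F_neg
    using assms by (simp add: qo_pow_closed iter_qm_closed pm_qm)
qed

lemma F_closed [simp, intro]:
  assumes "A \<in> ac_obj C" "B \<in> ac_obj C" "f \<in> ac_hom C A B"
  shows "F i A B f \<in> ac_hom C (P i A) (P i B)"
proof (cases "0 \<le> i")
  case True
  have "F (int n) A B f \<in> ac_hom C (P (int n) A) (P (int n) B)" for n
  proof (induction n)
    case (Suc n)
    then show ?case using assms F_succ[OF assms, of "int n"] P_succ[of _ "int n"]
      by (simp add: pm_closed add.commute)
  qed (use assms in simp)
  from this[of "nat i"] True show ?thesis by simp
next
  case False
  have "F (- int n) A B f \<in> ac_hom C (P (- int n) A) (P (- int n) B)" for n
    unfolding P_neg F_neg using assms by (rule iter_qm_closed)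
  from this[of "nat (- i)"] False show ?thesis by simp
qed

text \<open>Raising \<open>i\<close> by one applies \<open>po\<close> to both sides, and
  \<open>po\<close> is injective on objects, so the claims for \<open>i\<close> and
  \<open>i + 1\<close> are equivalent.\<close>

lemma P_add [simp]:
  assumes A: "A \<in> ac_obj C"
  shows "P i (P j A) = P (i + j) A"
proof (induction i rule: int_iff_induct)
  case (step i)
  have "P (i + 1) (P j A) = po (P i (P j A))" "P (i + 1 + j) A = po (P (i + j) A)"
    using A P_succ[of "P j A" i] P_succ[of A "i + j"] by (simp_all add: ac_simps)
  then show ?case using A po_bij by (auto simp: bij_betw_def dest: inj_onD)
qed simp

text \<open>Each law below is equivalent for \<open>i\<close> and for \<open>i + 1\<close>, because \<open>\<Phi>\<close> is faithful;
  so nothing has to be checked for the inverse functor separately.\<close>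

lemma F_add_exp:
  assumes o: "A \<in> ac_obj C" "B \<in> ac_obj C" and f: "f \<in> ac_hom C A B"
  shows "F i (P j A) (P j B) (F j A B f) = F (i + j) A B f"
proof (induction i rule: int_iff_induct)
  case (step i)
  have j: "i + 1 + j = i + j + 1" by simp
  have closed: "F i (P j A) (P j B) (F j A B f) \<in> ac_hom C (P (i + j) A) (P (i + j) B)"
    using F_closed[of "P j A" "P j B" "F j A B f" i] o f by simp
  have "F (i + 1) (P j A) (P j B) (F j A B f) =
      pm (P (i + j) A) (P (i + j) B) (F i (P j A) (P j B) (F j A B f))"
    using F_succ[of "P j A" "P j B" "F j A B f" i] o f by simp
  moreover have "F (i + 1 + j) A B f = pm (P (i + j) A) (P (i + j) B) (F (i + j) A B f)"
    unfolding j by (rule F_succ[OF o f])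
  ultimately show ?case using o f closed by (simp add: pm_eq_iff)
qed simp

lemma F_comp:
  assumes o: "A \<in> ac_obj C" "B \<in> ac_obj C" "E \<in> ac_obj C"
    and fg: "f \<in> ac_hom C A B" "g \<in> ac_hom C B E"
  shows "F i A E (ac_comp C A B E g f) = ac_comp C (P i A) (P i B) (P i E) (F i B E g) (F i A B f)"
proof (induction i rule: int_iff_induct)
  case (step i)
  have "F (i + 1) A E (ac_comp C A B E g f) = pm (P i A) (P i E) (F i A E (ac_comp C A B E g f))"
    using o fg by (intro F_succ comp_closed)
  moreover have "ac_comp C (P (i + 1) A) (P (i + 1) B) (P (i + 1) E) (F (i + 1) B E g) (F (i + 1) A B f)
      = pm (P i A) (P i E) (ac_comp C (P i A) (P i B) (P i E) (F i B E g) (F i A B f))"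
    by (simp only: F_succ o fg P_succ pm_comp P_closed F_closed)
  ultimately show ?case using o fg by (simp add: pm_eq_iff)
qed simp

lemma F_add:
  assumes o: "A \<in> ac_obj C" "B \<in> ac_obj C" and fg: "f \<in> ac_hom C A B" "g \<in> ac_hom C A B"
  shows "F i A B (ac_add C A B f g) = ac_add C (P i A) (P i B) (F i A B f) (F i A B g)"
proof (induction i rule: int_iff_induct)
  case (step i)
  have "F (i + 1) A B (ac_add C A B f g) = pm (P i A) (P i B) (F i A B (ac_add C A B f g))"
    using o fg by (intro F_succ add_closed)
  moreover have "ac_add C (P (i + 1) A) (P (i + 1) B) (F (i + 1) A B f) (F (i + 1) A B g)
      = pm (P i A) (P i B) (ac_add C (P i A) (P i B) (F i A B f) (F i A B g))"
    by (simp only: F_succ o fg P_succ pm_add P_closed F_closed)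
  ultimately show ?case using o fg by (simp add: pm_eq_iff)
qed simp

lemma F_id [simp]:
  assumes A: "A \<in> ac_obj C"
  shows "F i A A (ac_id C A) = ac_id C (P i A)"
proof (induction i rule: int_iff_induct)
  case (step i)
  have "F (i + 1) A A (ac_id C A) = pm (P i A) (P i A) (F i A A (ac_id C A))"
    using A by (intro F_succ id_closed)
  moreover have "ac_id C (P (i + 1) A) = pm (P i A) (P i A) (ac_id C (P i A))"
    by (simp only: A P_succ pm_id P_closed)
  ultimately show ?case using A by (simp add: pm_eq_iff)
qed simp

lemma F_zero_mor [simp]:
  assumes "A \<in> ac_obj C" "B \<in> ac_obj C"
  shows "F i A B (ac_zero C A B) = ac_zero C (P i A) (P i B)"
proof -
  let ?x = "F i A B (ac_zero C A B)"
  have "ac_add C (P i A) (P i B) ?x ?x = ac_add C (P i A) (P i B) ?x (ac_zero C (P i A) (P i B))"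
    using assms by (simp flip: F_add)
  then show ?thesis using assms by (subst (asm) hom_group(7)) auto
qed

lemma F_msum:
  assumes [simp]: "A \<in> ac_obj C" "B \<in> ac_obj C" "finite I" and "\<And>i. i \<in> I \<Longrightarrow> f i \<in> ac_hom C A B"
  shows "F k A B (msum A B f I) = msum (P k A) (P k B) (\<lambda>i. F k A B (f i)) I"
  by (rule finprod_hom) (use assms in \<open>auto simp: hom_def F_add intro: hom_comm_group\<close>)

section \<open>Formal sums and their composition\<close>

lemma tw_hom: "f \<in> ac_hom D A B \<longleftrightarrow> (\<forall>i. f i \<in> ac_hom C (P i A) B) \<and>
    finite (tw_support C po A B f) \<and> (\<forall>i. \<not> Q i \<longrightarrow> f i = ac_zero C (P i A) B)"
  by (simp add: twisted_def)

lemma tw_homI: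
  assumes "\<And>i. f i \<in> ac_hom C (P i A) B" "finite I" "\<And>i. i \<notin> I \<Longrightarrow> f i = ac_zero C (P i A) B"
    and "\<And>i. \<not> Q i \<Longrightarrow> f i = ac_zero C (P i A) B"
  shows "f \<in> ac_hom D A B"
proof -
  have "tw_support C po A B f \<subseteq> I" using assms(3) by (auto simp: tw_support_def)
  then show ?thesis using assms finite_subset by (auto simp: tw_hom)
qed

lemma tw_hom_coeff [simp]: "f \<in> ac_hom D A B \<Longrightarrow> f i \<in> ac_hom C (P i A) B"
  by (simp add: tw_hom)

lemma tw_hom_coeff_zero: "f \<in> ac_hom D A B \<Longrightarrow> \<not> Q i \<Longrightarrow> f i = ac_zero C (P i A) B"
  by (simp add: tw_hom)

definition tw_term :: "'o \<Rightarrow> 'o \<Rightarrow> 'o \<Rightarrow> (int \<Rightarrow> 'f) \<Rightarrow> (int \<Rightarrow> 'f) \<Rightarrow> int \<Rightarrow> int \<Rightarrow> 'f" where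
  "tw_term A B E g f k i =
     ac_comp C (P k A) (P (k - i) B) E (g (k - i)) (F (k - i) (P i A) B (f i))"

lemma F_coeff [simp]:
  assumes "A \<in> ac_obj C" "B \<in> ac_obj C" "f \<in> ac_hom C (P i A) B"
  shows "F (k - i) (P i A) B f \<in> ac_hom C (P k A) (P (k - i) B)"
  using F_closed[of "P i A" B f "k - i"] assms by simp

lemma tw_term_closed [simp]:
  assumes "A \<in> ac_obj C" "B \<in> ac_obj C" "E \<in> ac_obj C" "f \<in> ac_hom D A B" "g \<in> ac_hom D B E"
  shows "tw_term A B E g f k i \<in> ac_hom C (P k A) E"
  unfolding tw_term_def using assms by (intro comp_closed) auto

lemma tw_term_zero:
  assumes "A \<in> ac_obj C" "B \<in> ac_obj C" "E \<in> ac_obj C" "f \<in> ac_hom D A B" "g \<in> ac_hom D B E"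
    and "f i = ac_zero C (P i A) B \<or> g (k - i) = ac_zero C (P (k - i) B) E"
  shows "tw_term A B E g f k i = ac_zero C (P k A) E"
proof -
  have "F (k - i) (P i A) B (ac_zero C (P i A) B) = ac_zero C (P k A) (P (k - i) B)"
    using F_zero_mor[of "P i A" B "k - i"] assms by simp
  then show ?thesis using assms unfolding tw_term_def by auto
qed

text \<open>The definition sums over the support of \<open>f\<close>, which changes from one
  morphism to the next. Allowing any finite superset provides common index sets for additivity and
  for the interchange of sums.\<close>

lemma tw_comp:
  assumes "A \<in> ac_obj C" "B \<in> ac_obj C" "E \<in> ac_obj C" "f \<in> ac_hom D A B" "g \<in> ac_hom D B E"
    and "finite I" "\<And>i. i \<notin> I \<Longrightarrow> f i = ac_zero C (P i A) B"
  shows "ac_comp D A B E g f k = msum (P k A) E (tw_term A B E g f k) I"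
proof -
  have "ac_comp D A B E g f k = msum (P k A) E (tw_term A B E g f k) (tw_support C po A B f)"
    unfolding twisted_def tw_term_def[abs_def] by simp
  also have "\<dots> = msum (P k A) E (tw_term A B E g f k) I"
  proof (rule msum_mono_neutral)
    show "tw_support C po A B f \<subseteq> I" using assms(7) by (auto simp: tw_support_def)
    fix i
    show "tw_term A B E g f k i = ac_zero C (P k A) E" if "i \<in> I - tw_support C po A B f"
      using that assms(1-5) by (intro tw_term_zero) (auto simp: tw_support_def)
    show "tw_term A B E g f k i \<in> ac_hom C (P k A) E" using assms(1-5) by (rule tw_term_closed)
  qed (use assms in simp_all)
  finally show ?thesis .
qed

lemma tw_finite: "f \<in> ac_hom D A B \<Longrightarrow> finite (tw_support C po A B f)"
  by (simp add: tw_hom)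

lemma not_tw_support: "i \<notin> tw_support C po A B f \<Longrightarrow> f i = ac_zero C (P i A) B"
  by (simp add: tw_support_def)

lemma tw_comp_support:
  assumes "A \<in> ac_obj C" "B \<in> ac_obj C" "E \<in> ac_obj C" "f \<in> ac_hom D A B" "g \<in> ac_hom D B E"
  shows "ac_comp D A B E g f k = msum (P k A) E (tw_term A B E g f k) (tw_support C po A B f)"
  using assms tw_finite not_tw_support by (intro tw_comp) auto

text \<open>The support of a composite lies in the sumset of the supports. This gives its finiteness
  and, as admissible exponents add, the closure of the polynomial subcategories under
  composition.\<close>

lemma tw_comp_not_zero:
  assumes "A \<in> ac_obj C" "B \<in> ac_obj C" "E \<in> ac_obj C" "f \<in> ac_hom D A B" "g \<in> ac_hom D B E"
    and "ac_comp D A B E g f k \<noteq> ac_zero C (P k A) E"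
  obtains i j where "k = i + j" "f i \<noteq> ac_zero C (P i A) B" "g j \<noteq> ac_zero C (P j B) E"
proof (rule ccontr)
  assume "\<not> thesis"
  then have "f i = ac_zero C (P i A) B \<or> g (k - i) = ac_zero C (P (k - i) B) E" for i
    using that[of i "k - i"] by auto
  then have "tw_term A B E g f k i = ac_zero C (P k A) E" for i
    using assms by (intro tw_term_zero) auto
  then show False
    using assms(1,3,6) tw_comp_support[OF assms(1-5), of k]
    by (metis (no_types, lifting) P_closed msum_zero)
qed

lemma tw_comp_closed:
  assumes "A \<in> ac_obj C" "B \<in> ac_obj C" "E \<in> ac_obj C" "f \<in> ac_hom D A B" "g \<in> ac_hom D B E"
  shows "ac_comp D A B E g f \<in> ac_hom D A E"
proof (rule tw_homI)
  show "finite ((\<lambda>(i, j). i + j) ` (tw_support C po A B f \<times> tw_support C po B E g))"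
    using assms tw_finite by blast
  fix k
  show "ac_comp D A B E g f k \<in> ac_hom C (P k A) E"
    using assms by (auto simp: tw_comp_support intro!: msum_closed)
  show "ac_comp D A B E g f k = ac_zero C (P k A) E"
    if "k \<notin> (\<lambda>(i, j). i + j) ` (tw_support C po A B f \<times> tw_support C po B E g)"
  proof (rule ccontr)
    assume "ac_comp D A B E g f k \<noteq> ac_zero C (P k A) E"
    then show False
      by (rule tw_comp_not_zero[OF assms]) (use that in \<open>force simp: tw_support_def\<close>)
  qed
  show "ac_comp D A B E g f k = ac_zero C (P k A) E" if "\<not> Q k"
  proof (rule ccontr)
    assume "ac_comp D A B E g f k \<noteq> ac_zero C (P k A) E"
    then show False
      by (rule tw_comp_not_zero[OF assms]) (use that Q_add tw_hom_coeff_zero assms(4,5) in blast)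
  qed
qed

text \<open>The monomial \<open>u t^i\<close> with \<open>u : \<Phi>^i A -> B\<close>.\<close>

definition mono_mor :: "'o \<Rightarrow> 'o \<Rightarrow> int \<Rightarrow> 'f \<Rightarrow> int \<Rightarrow> 'f" where
  "mono_mor A B i u = (\<lambda>j. if j = i then u else ac_zero C (P j A) B)"

lemma mono_mor_closed [simp]:
  assumes "A \<in> ac_obj C" "B \<in> ac_obj C" "Q i" "u \<in> ac_hom C (P i A) B"
  shows "mono_mor A B i u \<in> ac_hom D A B"
  by (rule tw_homI[of _ _ _ "{i}"]) (use assms in \<open>auto simp: mono_mor_def\<close>)

lemma comp_mono_mor:
  assumes "A \<in> ac_obj C" "B \<in> ac_obj C" "E \<in> ac_obj C" "Q i" "u \<in> ac_hom C (P i A) B"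
    "g \<in> ac_hom D B E"
  shows "ac_comp D A B E g (mono_mor A B i u) k =
    ac_comp C (P k A) (P (k - i) B) E (g (k - i)) (F (k - i) (P i A) B u)"
proof -
  have "ac_comp D A B E g (mono_mor A B i u) k = msum (P k A) E (tw_term A B E g (mono_mor A B i u) k) {i}"
    using assms mono_mor_closed[OF assms(1,2,4,5)] by (intro tw_comp) (auto simp: mono_mor_def)
  also have "\<dots> = tw_term A B E g (mono_mor A B i u) k i"
    using assms by (intro msum_sing) auto
  finally show ?thesis by (simp add: tw_term_def mono_mor_def)
qed

lemma tw_id: "A \<in> ac_obj C \<Longrightarrow> ac_id D A = mono_mor A A 0 (ac_id C A)"
  by (auto simp: mono_mor_def)

lemma tw_comp_id:
  assumes "A \<in> ac_obj C" "B \<in> ac_obj C" "f \<in> ac_hom D A B"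
  shows "ac_comp D A B B (ac_id D B) f = f" "ac_comp D A A B f (ac_id D A) = f"
proof -
  show "ac_comp D A A B f (ac_id D A) = f"
    using assms Q_zero unfolding tw_id[OF assms(1)] by (intro ext) (simp add: comp_mono_mor)
  have id: "ac_id D B \<in> ac_hom D B B" using assms Q_zero by (simp only: tw_id) simp
  show "ac_comp D A B B (ac_id D B) f = f"
  proof
    fix k
    \<comment> \<open>The surviving term has index \<open>k\<close>, which is missing from the
      support when \<open>f k\<close> vanishes.\<close>
    let ?I = "insert k (tw_support C po A B f)"
    have "ac_comp D A B B (ac_id D B) f k = msum (P k A) B (tw_term A B B (ac_id D B) f k) ?I"
      using assms id tw_finite by (intro tw_comp) (auto simp: tw_support_def)
    also have "\<dots> = tw_term A B B (ac_id D B) f k k"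
    proof (rule msum_single)
      fix i assume "i \<noteq> k"
      then show "tw_term A B B (ac_id D B) f k i = ac_zero C (P k A) B"
        using assms id by (intro tw_term_zero) auto
    qed (use assms id tw_finite in auto)
    also have "\<dots> = f k" using assms by (simp add: tw_term_def)
    finally show "ac_comp D A B B (ac_id D B) f k = f k" .
  qed
qed

text \<open>Both sides are the double sum, over the exponent \<open>i\<close> of \<open>f\<close>
  and the degree \<open>l\<close> of the composite of \<open>f\<close> and \<open>g\<close>, of the
  terms \<open>h_(k-l) \<Phi>^(k-l)(g_(l-i)) \<Phi>^(k-i)(f_i)\<close>. The left side needs that
  \<open>\<Phi>^(k-l)\<close> is an additive functor and that
  \<open>\<Phi>^(k-l) \<Phi>^(l-i) = \<Phi>^(k-i)\<close>.\<close>

lemma tw_comp_assoc: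
  assumes A: "A \<in> ac_obj C" and B: "B \<in> ac_obj C" and E: "E \<in> ac_obj C" and G: "G \<in> ac_obj C"
    and f: "f \<in> ac_hom D A B" and g: "g \<in> ac_hom D B E" and h: "h \<in> ac_hom D E G"
  shows "ac_comp D A E G h (ac_comp D A B E g f) = ac_comp D A B G (ac_comp D B E G h g) f"
proof
  fix k
  note [simp] = A B E G f g h tw_comp_closed
  let ?I = "tw_support C po A B f" and ?J = "tw_support C po B E g"
  \<comment> \<open>One index set for \<open>l\<close> on both sides: it contains every degree in
    which the composite of \<open>f\<close> and \<open>g\<close> is nonzero, and for each
    \<open>i\<close> in \<open>?I\<close> its shift by \<open>- i\<close> contains the support of
    \<open>g\<close>.\<close>
  define L where "L = (\<lambda>(i, j). i + j) ` (?I \<times> ?J)"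
  have fin [simp]: "finite ?I" "finite ?J" "finite L" using f g tw_finite unfolding L_def by blast+
  have L: "ac_comp D A B E g f l = ac_zero C (P l A) E" if "l \<notin> L" for l
  proof (rule ccontr)
    assume "ac_comp D A B E g f l \<noteq> ac_zero C (P l A) E"
    then show False
      by (rule tw_comp_not_zero[OF A B E f g]) (use that in \<open>force simp: tw_support_def L_def\<close>)
  qed
  define \<phi> where "\<phi> i = F (k - i) (P i A) B (f i)" for i
  define \<gamma> where "\<gamma> i l = F (k - l) (P (l - i) B) E (g (l - i))" for i l
  have \<phi> [simp]: "\<phi> i \<in> ac_hom C (P k A) (P (k - i) B)" for i
    unfolding \<phi>_def by simp
  have \<gamma> [simp]: "\<gamma> i l \<in> ac_hom C (P (k - i) B) (P (k - l) E)" for i l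
    unfolding \<gamma>_def using F_closed[of "P (l - i) B" E "g (l - i)" "k - l"] by simp
  have h' [simp]: "h j \<in> ac_hom C (P j E) G" for j by (rule tw_hom_coeff[OF h])
  let ?t = "\<lambda>i l. ac_comp C (P k A) (P (k - i) B) G
      (ac_comp C (P (k - i) B) (P (k - l) E) G (h (k - l)) (\<gamma> i l)) (\<phi> i)"
  have t [simp]: "?t i l \<in> ac_hom C (P k A) G" for i l
    by (intro comp_closed) auto
  have left: "tw_term A E G h (ac_comp D A B E g f) k l = msum (P k A) G (\<lambda>i. ?t i l) ?I" for l
  proof -
    have 1: "F (k - l) (P l A) E (tw_term A B E g f l i) =
        ac_comp C (P k A) (P (k - i) B) (P (k - l) E) (\<gamma> i l) (\<phi> i)" for i
    proof -
      have "F (k - l) (P l A) (P (l - i) B) (F (l - i) (P i A) B (f i)) = \<phi> i"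
        using F_add_exp[of "P i A" B "f i" "k - l" "l - i"] by (simp add: \<phi>_def)
      moreover have "F (k - l) (P l A) E (tw_term A B E g f l i) =
        ac_comp C (P (k - l) (P l A)) (P (k - l) (P (l - i) B)) (P (k - l) E)
          (F (k - l) (P (l - i) B) E (g (l - i)))
          (F (k - l) (P l A) (P (l - i) B) (F (l - i) (P i A) B (f i)))"
        unfolding tw_term_def by (intro F_comp) auto
      ultimately show ?thesis by (simp add: \<gamma>_def)
    qed
    have "F (k - l) (P l A) E (ac_comp D A B E g f l) =
        F (k - l) (P l A) E (msum (P l A) E (tw_term A B E g f l) ?I)"
      by (subst tw_comp_support) auto
    also have "\<dots> = msum (P (k - l) (P l A)) (P (k - l) E)
        (\<lambda>i. F (k - l) (P l A) E (tw_term A B E g f l i)) ?I"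
      by (intro F_msum) auto
    also have "\<dots> = msum (P k A) (P (k - l) E)
        (\<lambda>i. ac_comp C (P k A) (P (k - i) B) (P (k - l) E) (\<gamma> i l) (\<phi> i)) ?I"
      by (simp add: 1)
    finally have "tw_term A E G h (ac_comp D A B E g f) k l =
       ac_comp C (P k A) (P (k - l) E) G (h (k - l)) (msum (P k A) (P (k - l) E)
        (\<lambda>i. ac_comp C (P k A) (P (k - i) B) (P (k - l) E) (\<gamma> i l) (\<phi> i)) ?I)"
      by (simp add: tw_term_def)
    also have "\<dots> = msum (P k A) G (\<lambda>i. ac_comp C (P k A) (P (k - l) E) G (h (k - l))
        (ac_comp C (P k A) (P (k - i) B) (P (k - l) E) (\<gamma> i l) (\<phi> i))) ?I"
      by (intro comp_msum_right) auto
    also have "\<dots> = msum (P k A) G (\<lambda>i. ?t i l) ?I"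
      by (intro msum_cong comp_assoc) auto
    finally show ?thesis .
  qed
  have right: "tw_term A B G (ac_comp D B E G h g) f k i = msum (P k A) G (\<lambda>l. ?t i l) L"
    if i: "i \<in> ?I" for i
  proof -
    have sub: "g j = ac_zero C (P j B) E" if "j \<notin> (\<lambda>l. l - i) ` L" for j
    proof (rule ccontr)
      assume "g j \<noteq> ac_zero C (P j B) E"
      then have "i + j \<in> L" using i unfolding L_def by (force simp: tw_support_def)
      then show False using that by force
    qed
    have "ac_comp D B E G h g (k - i) =
        msum (P (k - i) B) G (tw_term B E G h g (k - i)) ((\<lambda>l. l - i) ` L)"
      using sub by (intro tw_comp) auto
    also have "\<dots> = msum (P (k - i) B) G (\<lambda>l. tw_term B E G h g (k - i) (l - i)) L"
      by (intro msum_reindex) (auto simp: inj_on_def)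
    also have "\<dots> = msum (P (k - i) B) G
        (\<lambda>l. ac_comp C (P (k - i) B) (P (k - l) E) G (h (k - l)) (\<gamma> i l)) L"
      by (simp add: tw_term_def \<gamma>_def)
    finally have "tw_term A B G (ac_comp D B E G h g) f k i =
        ac_comp C (P k A) (P (k - i) B) G (msum (P (k - i) B) G
        (\<lambda>l. ac_comp C (P (k - i) B) (P (k - l) E) G (h (k - l)) (\<gamma> i l)) L) (\<phi> i)"
      by (simp add: tw_term_def \<phi>_def)
    also have "\<dots> = msum (P k A) G (\<lambda>l. ?t i l) L"
      by (intro comp_msum_left) auto
    finally show ?thesis .
  qed
  have "ac_comp D A E G h (ac_comp D A B E g f) k =
      msum (P k A) G (tw_term A E G h (ac_comp D A B E g f) k) L"
    using L by (intro tw_comp) auto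
  also have "\<dots> = msum (P k A) G (\<lambda>l. msum (P k A) G (\<lambda>i. ?t i l) ?I) L"
    by (rule msum_cong) (simp_all add: left msum_closed)
  also have "\<dots> = msum (P k A) G (\<lambda>i. msum (P k A) G (\<lambda>l. ?t i l) L) ?I"
    by (rule msum_swap) simp_all
  also have "\<dots> = msum (P k A) G (tw_term A B G (ac_comp D B E G h g) f k) ?I"
    by (rule msum_cong) (simp_all add: right msum_closed)
  also have "\<dots> = ac_comp D A B G (ac_comp D B E G h g) f k"
    by (subst tw_comp_support) auto
  finally show "ac_comp D A E G h (ac_comp D A B E g f) k = ac_comp D A B G (ac_comp D B E G h g) f k" .
qed

section \<open>The additive structure of the twisted category\<close>

lemma tw_add_closed:
  assumes "A \<in> ac_obj C" "B \<in> ac_obj C" "f \<in> ac_hom D A B" "g \<in> ac_hom D A B"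
  shows "ac_add D A B f g \<in> ac_hom D A B"
  by (rule tw_homI[of _ _ _ "tw_support C po A B f \<union> tw_support C po A B g"])
    (use assms tw_finite in \<open>auto simp: not_tw_support tw_hom_coeff_zero\<close>)

lemma tw_zero_closed: "A \<in> ac_obj C \<Longrightarrow> B \<in> ac_obj C \<Longrightarrow> ac_zero D A B \<in> ac_hom D A B"
  by (rule tw_homI[of _ _ _ "{}"]) auto

lemma tw_comm_group:
  assumes A: "A \<in> ac_obj C" and B: "B \<in> ac_obj C"
  shows "comm_group (hom_grp D A B)"
proof -
  obtain u where u: "u \<in> ac_hom C B B" "ac_add C B B u (ac_id C B) = ac_zero C B B"
    using B by (rule neg_id_exists)
  show ?thesis
  proof (rule comm_groupI)
    fix f assume "f \<in> carrier (hom_grp D A B)"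
    then have f: "f \<in> ac_hom D A B" by (simp add: hom_grp_def)
    \<comment> \<open>Negation by composing with the negative identity of the target
      \<open>B\<close>, the same for all coefficients, whereas their sources vary with
      \<open>i\<close>.\<close>
    let ?g = "\<lambda>i. ac_comp C (P i A) B B u (f i)"
    have "?g \<in> ac_hom D A B"
      by (rule tw_homI[of _ _ _ "tw_support C po A B f"])
        (use A B f u tw_finite in \<open>auto simp: not_tw_support tw_hom_coeff_zero\<close>)
    moreover have "ac_add C (P i A) B (?g i) (f i) = ac_zero C (P i A) B" for i
      using comp_add(1)[of "P i A" B B "f i" u "ac_id C B"] u A B f by simp
    ultimately show "\<exists>g\<in>carrier (hom_grp D A B). g \<otimes>\<^bsub>hom_grp D A B\<^esub> f = \<one>\<^bsub>hom_grp D A B\<^esub>"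
      by (intro bexI[of _ ?g]) (auto simp: hom_grp_def)
  qed (use A B hom_group(5,6)[of _ B] tw_zero_closed[of A B] tw_add_closed[of A B]
      in \<open>auto simp: hom_grp_def\<close>)
qed

lemma tw_comp_add:
  assumes A: "A \<in> ac_obj C" and B: "B \<in> ac_obj C" and E: "E \<in> ac_obj C"
    and f: "f \<in> ac_hom D A B" and g: "g \<in> ac_hom D B E"
  shows "g' \<in> ac_hom D B E \<Longrightarrow> ac_comp D A B E (ac_add D B E g g') f
          = ac_add D A E (ac_comp D A B E g f) (ac_comp D A B E g' f)"
    and "f' \<in> ac_hom D A B \<Longrightarrow> ac_comp D A B E g (ac_add D A B f f')
          = ac_add D A E (ac_comp D A B E g f) (ac_comp D A B E g f')"
proof -
  assume g': "g' \<in> ac_hom D B E"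
  show "ac_comp D A B E (ac_add D B E g g') f = ac_add D A E (ac_comp D A B E g f) (ac_comp D A B E g' f)"
  proof
    fix k
    have "ac_comp D A B E (ac_add D B E g g') f k =
        msum (P k A) E (tw_term A B E (ac_add D B E g g') f k) (tw_support C po A B f)"
      using assms g' by (intro tw_comp_support) (auto intro: tw_add_closed simp del: tw_simps)
    also have "\<dots> = msum (P k A) E (\<lambda>i. ac_add C (P k A) E (tw_term A B E g f k i) (tw_term A B E g' f k i))
        (tw_support C po A B f)"
      using assms g' by (intro msum_cong) (auto simp: tw_term_def comp_add)
    also have "\<dots> = ac_add D A E (ac_comp D A B E g f) (ac_comp D A B E g' f) k"
      using assms g' by (subst msum_add) (auto simp: tw_comp_support)
    finally show "ac_comp D A B E (ac_add D B E g g') f k =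
      ac_add D A E (ac_comp D A B E g f) (ac_comp D A B E g' f) k" .
  qed
next
  assume f': "f' \<in> ac_hom D A B"
  \<comment> \<open>\<open>f\<close>, \<open>f'\<close> and their sum have different supports; the
    union serves all three.\<close>
  let ?I = "tw_support C po A B f \<union> tw_support C po A B f'"
  show "ac_comp D A B E g (ac_add D A B f f') = ac_add D A E (ac_comp D A B E g f) (ac_comp D A B E g f')"
  proof
    fix k
    have comp: "ac_comp D A B E g x k = msum (P k A) E (tw_term A B E g x k) ?I"
      if "x \<in> {f, f', ac_add D A B f f'}" for x
      using that assms f' tw_add_closed[OF A B f f'] tw_finite
      by (intro tw_comp) (auto simp: not_tw_support)
    have "ac_comp D A B E g (ac_add D A B f f') k = msum (P k A) E (tw_term A B E g (ac_add D A B f f') k) ?I"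
      by (rule comp) simp
    also have "\<dots> = msum (P k A) E (\<lambda>i. ac_add C (P k A) E (tw_term A B E g f k i) (tw_term A B E g f' k i)) ?I"
    proof (rule msum_cong)
      fix i
      have "F (k - i) (P i A) B (ac_add C (P i A) B (f i) (f' i)) =
        ac_add C (P k A) (P (k - i) B) (F (k - i) (P i A) B (f i)) (F (k - i) (P i A) B (f' i))"
        using F_add[of "P i A" B "f i" "f' i" "k - i"] assms f' by simp
      then show "tw_term A B E g (ac_add D A B f f') k i =
          ac_add C (P k A) E (tw_term A B E g f k i) (tw_term A B E g f' k i)"
        using assms f' by (simp add: tw_term_def comp_add)
    qed (use assms f' in auto)
    also have "\<dots> = ac_add D A E (ac_comp D A B E g f) (ac_comp D A B E g f') k"
      using assms f' comp by (subst msum_add) auto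
    finally show "ac_comp D A B E g (ac_add D A B f f') k =
      ac_add D A E (ac_comp D A B E g f) (ac_comp D A B E g f') k" .
  qed
qed

lemma preadditive_twisted: "preadditive D"
proof
  have "ac_id D A \<in> ac_hom D A A" if "A \<in> ac_obj C" for A
    using that Q_zero by (simp only: tw_id) simp
  then have "is_category D"
    unfolding is_category_def tw_simps(1)
    by (intro conjI ballI tw_comp_closed tw_comp_id tw_comp_assoc) auto
  then show "is_preadditive D"
    unfolding is_preadditive_def tw_simps(1)
    by (intro conjI ballI tw_comp_add tw_comm_group) auto
qed

end

section \<open>Hilbert's basis theorem\<close>

context twisted_category
begin

text \<open>The power \<open>t^i\<close> with target \<open>A\<close>. The source has to be
  \<open>\<Phi>^(-i) A\<close> for its coefficient, a morphism from \<open>\<Phi>^i\<close> of the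
  source to \<open>A\<close>, to be an identity.\<close>

definition t_power :: "int \<Rightarrow> 'o \<Rightarrow> int \<Rightarrow> 'f" where
  "t_power i A = mono_mor (P (- i) A) A i (ac_id C A)"

lemma t_power_closed [simp]: "A \<in> ac_obj C \<Longrightarrow> Q i \<Longrightarrow> t_power i A \<in> ac_hom D (P (- i) A) A"
  unfolding t_power_def by (rule mono_mor_closed) auto

text \<open>Composition twists the coefficients of the factor applied first. Here that coefficient
  is an identity, so the coefficients of \<open>f\<close> are shifted and otherwise
  untouched.\<close>

lemma comp_t_power:
  assumes "A \<in> ac_obj C" "B \<in> ac_obj C" "f \<in> ac_hom D A B" "Q i"
  shows "ac_comp D (P (- i) A) A B f (t_power i A) k = f (k - i)"
  using assms tw_hom_coeff[OF assms(3), of "k - i"] unfolding t_power_def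
  by (subst comp_mono_mor) auto

lemma is_module_hom_module_twisted: "B \<in> ac_obj C \<Longrightarrow> is_module D (hom_module D B)"
  by (rule preadditive.is_module_hom_module[OF preadditive_twisted]) simp

lemma category_module_twisted: "B \<in> ac_obj C \<Longrightarrow> category_module D (hom_module D B)"
  by (intro category_module.intro preadditive_twisted category_module_axioms.intro
      is_module_hom_module_twisted)

end

text \<open>The sign \<open>s\<close> covers \<open>\<A>\<^sub>\<Phi>[t]\<close> and \<open>\<A>\<^sub>\<Phi>[t\<^sup>-\<^sup>1]\<close> at once; the degree is the exponent
  times \<open>s\<close>.\<close>

locale twisted_polynomials = twisted_category C po pm "\<lambda>i. 0 \<le> s * i"
  for C :: "('o, 'f) addcat" and po :: "'o \<Rightarrow> 'o" and pm :: "'o \<Rightarrow> 'o \<Rightarrow> 'f \<Rightarrow> 'f" and s :: int +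
  assumes sign: "s = 1 \<or> s = - 1"
begin

lemma sign_sq: "s * (s * i) = i"
  using sign by auto

section \<open>Ideals of leading coefficients\<close>

definition deg_le :: "nat \<Rightarrow> 'o \<Rightarrow> 'o \<Rightarrow> (int \<Rightarrow> 'f) \<Rightarrow> bool" where
  "deg_le n A B f \<longleftrightarrow> (\<forall>m>n. f (s * int m) = ac_zero C (P (s * int m) A) B)"

text \<open>The degree is only bounded by \<open>n\<close>, so the coefficient may vanish; with
  exact degree \<open>n\<close> the set would lack zero and not be closed under addition.\<close>

definition lead :: "'o \<Rightarrow> ('o \<Rightarrow> (int \<Rightarrow> 'f) set) \<Rightarrow> nat \<Rightarrow> 'o \<Rightarrow> 'f set" where
  "lead B S n X = {f (s * int n) | f. f \<in> S (P (- (s * int n)) X) \<and> deg_le n (P (- (s * int n)) X) B f}"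

lemma leadI: "f \<in> S (P (- (s * int n)) X) \<Longrightarrow> deg_le n (P (- (s * int n)) X) B f \<Longrightarrow>
    x = f (s * int n) \<Longrightarrow> x \<in> lead B S n X"
  unfolding lead_def by blast

lemma leadE:
  assumes "x \<in> lead B S n X"
  obtains f where "f \<in> S (P (- (s * int n)) X)" "deg_le n (P (- (s * int n)) X) B f" "x = f (s * int n)"
  using assms unfolding lead_def by blast

lemma submodule_lead:
  assumes B: "B \<in> ac_obj C" and S: "submodule D (hom_module D B) S"
  shows "submodule C (hom_module C B) (lead B S n)"
proof -
  interpret H: category_module C "hom_module C B"
    by unfold_locales (rule is_module_hom_module[OF B])
  interpret K: category_module D "hom_module D B" by (rule category_module_twisted[OF B])
  note S = K.submoduleD[OF S, unfolded tw_simps(1) hom_module_simps]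
  show ?thesis
  proof (rule H.submoduleI; unfold hom_module_simps)
    fix X assume X: "X \<in> ac_obj C"
    let ?A = "P (- (s * int n)) X"
    have A: "?A \<in> ac_obj C" using X by simp
    show "lead B S n X \<subseteq> ac_hom C X B"
    proof
      fix x assume "x \<in> lead B S n X"
      then obtain f where "f \<in> S ?A" "x = f (s * int n)" by (rule leadE)
      then show "x \<in> ac_hom C X B"
        using tw_hom_coeff[OF S(1)[OF A], of f "s * int n"] X by simp
    qed
    show "ac_zero C X B \<in> lead B S n X"
      by (rule leadI[where S = S and f = "ac_zero D ?A B"]) (use X S(2)[OF A] in \<open>auto simp: deg_le_def\<close>)
    fix x y assume "x \<in> lead B S n X" "y \<in> lead B S n X"
    then obtain f g where f: "f \<in> S ?A" "deg_le n ?A B f" "x = f (s * int n)"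
      and g: "g \<in> S ?A" "deg_le n ?A B g" "y = g (s * int n)"
      by (elim leadE)
    show "ac_add C X B x y \<in> lead B S n X"
      by (rule leadI[where S = S and f = "ac_add D ?A B f g"])
        (use X B f g S(3)[OF A f(1) g(1)] in \<open>auto simp: deg_le_def\<close>)
  next
    fix X Y h x assume X: "X \<in> ac_obj C" "Y \<in> ac_obj C" and h: "h \<in> ac_hom C X Y"
      and "x \<in> lead B S n Y"
    let ?A = "P (- (s * int n)) X" and ?E = "P (- (s * int n)) Y"
    obtain f where f: "f \<in> S ?E" "deg_le n ?E B f" "x = f (s * int n)"
      using \<open>x \<in> lead B S n Y\<close> by (rule leadE)
    have A: "?A \<in> ac_obj C" "?E \<in> ac_obj C" using X by simp_all
    have fhom: "f \<in> ac_hom D ?E B" using S(1)[OF A(2) f(1)] .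
    \<comment> \<open>\<open>f\<close> is multiplied by a constant morphism. In degree
      \<open>s * int n\<close> the composition twists it by the corresponding power of \<Phi>, so
      the inverse twist of \<open>h\<close> is taken.\<close>
    define h' where "h' = F (- (s * int n)) X Y h"
    have h': "h' \<in> ac_hom C ?A ?E" unfolding h'_def using X h by simp
    let ?m = "mono_mor ?A ?E 0 h'"
    have m: "?m \<in> ac_hom D ?A ?E" using A h' by simp
    have comp: "ac_comp D ?A ?E B f ?m k = ac_comp C (P k ?A) (P k ?E) B (f k) (F k ?A ?E h')" for k
      using comp_mono_mor[OF A B _ _ fhom, of 0 h' k] h' by simp
    have "F (s * int n) ?A ?E h' = h"
      unfolding h'_def using F_add_exp[OF X h, of "s * int n" "- (s * int n)"] by simp
    then have lead: "ac_comp D ?A ?E B f ?m (s * int n) = ac_comp C X Y B x h"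
      using comp[of "s * int n"] f(3) X by simp
    have "deg_le n ?A B (ac_comp D ?A ?E B f ?m)"
      unfolding deg_le_def
    proof (intro allI impI)
      fix m assume "n < m"
      then have "f (s * int m) = ac_zero C (P (s * int m) ?E) B"
        using f(2) by (simp add: deg_le_def)
      then show "ac_comp D ?A ?E B f ?m (s * int m) = ac_zero C (P (s * int m) ?A) B"
        unfolding comp using B A F_closed[OF A h', of "s * int m"] by (simp del: P_add)
    qed
    then show "ac_comp C X Y B x h \<in> lead B S n X"
      using S(4)[OF A m f(1)] lead by (intro leadI[where f = "ac_comp D ?A ?E B f ?m"]) auto
  qed
qed

text \<open>Multiplication by \<open>t^s\<close> on the right raises the degree by one. It moves the
  source from \<open>\<Phi>^(-s n) X\<close> to \<open>\<Phi>^(-s (n+1)) X\<close>, just as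
  \<open>lead\<close> prescribes for the next degree, and leaves the leading coefficient
  unchanged.\<close>

lemma lead_Suc:
  assumes B: "B \<in> ac_obj C" and S: "submodule D (hom_module D B) S" and X: "X \<in> ac_obj C"
  shows "lead B S n X \<subseteq> lead B S (Suc n) X"
proof
  interpret K: category_module D "hom_module D B" by (rule category_module_twisted[OF B])
  note S = K.submoduleD[OF S, unfolded tw_simps(1) hom_module_simps]
  fix x assume "x \<in> lead B S n X"
  let ?A = "P (- (s * int n)) X" and ?A' = "P (- (s * int (Suc n))) X"
  obtain f where f: "f \<in> S ?A" "deg_le n ?A B f" "x = f (s * int n)"
    using \<open>x \<in> lead B S n X\<close> by (rule leadE)
  have A: "?A \<in> ac_obj C" "?A' \<in> ac_obj C" using X by simp_all
  have A': "P (- s) ?A = ?A'" using X by (simp add: algebra_simps)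
  have Q: "0 \<le> s * s" by simp
  let ?g = "ac_comp D ?A' ?A B f (t_power s ?A)"
  have g: "?g k = f (k - s)" for k
    using comp_t_power[OF A(1) B S(1)[OF A(1) f(1)] Q, of k] unfolding A' .
  have gS: "?g \<in> S ?A'"
    using S(4)[OF A(2,1) _ f(1), of "t_power s ?A"] t_power_closed[OF A(1) Q] unfolding A' by blast
  have "deg_le (Suc n) ?A' B ?g"
    unfolding deg_le_def
  proof (intro allI impI)
    fix m assume "Suc n < m"
    then obtain m' where m: "m = Suc m'" "n < m'" by (cases m) auto
    have "s * int m - s = s * int m'" using m by (simp add: algebra_simps)
    moreover have "P (s * int m) ?A' = P (s * int m') ?A" using X m by (simp add: algebra_simps)
    ultimately show "?g (s * int m) = ac_zero C (P (s * int m) ?A') B"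
      using f(2) m(2) unfolding g deg_le_def by metis
  qed
  then show "x \<in> lead B S (Suc n) X"
    using gS f(3) g by (intro leadI[where f = ?g]) (auto simp: algebra_simps)
qed

lemma lead_mono:
  assumes "B \<in> ac_obj C" "submodule D (hom_module D B) S" "X \<in> ac_obj C" "m \<le> n"
  shows "lead B S m X \<subseteq> lead B S n X"
  using assms(4) by (rule lift_Suc_mono_le[rotated]) (rule lead_Suc[OF assms(1-3)])

text \<open>Descent on the degree: an element of \<open>T\<close> with the same leading coefficient
  is subtracted. The difference stays in \<open>S\<close>, as \<open>T\<close> lies in
  \<open>S\<close>, and has smaller degree.\<close>

lemma ideal_subset_of_lead_subset:
  assumes B: "B \<in> ac_obj C" and S: "submodule D (hom_module D B) S"
    and T: "submodule D (hom_module D B) T" and TS: "\<And>A. A \<in> ac_obj C \<Longrightarrow> T A \<subseteq> S A"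
    and lead: "\<And>n X. X \<in> ac_obj C \<Longrightarrow> lead B S n X \<subseteq> lead B T n X"
    and A: "A \<in> ac_obj C"
  shows "S A \<subseteq> T A"
proof
  interpret K: category_module D "hom_module D B" by (rule category_module_twisted[OF B])
  note SD = K.submoduleD[OF S, unfolded tw_simps(1) hom_module_simps]
  note TD = K.submoduleD[OF T, unfolded tw_simps(1) hom_module_simps]
  \<comment> \<open>The bound \<open>n\<close> is strict, so \<open>n = 0\<close> leaves only the
    zero morphism, and a bound \<open>Suc n\<close> corresponds to \<open>deg_le n\<close>.\<close>
  have main: "f \<in> T A"
    if "f \<in> S A" "\<forall>m\<ge>n. f (s * int m) = ac_zero C (P (s * int m) A) B" for n f
    using that
  proof (induction n arbitrary: f)
    case 0
    have "f i = ac_zero C (P i A) B" for i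
    proof (cases "0 \<le> s * i")
      case True
      then have "s * int (nat (s * i)) = i" by (simp add: sign_sq)
      then show ?thesis using 0(2) by (metis le0)
    next
      case False
      then show ?thesis using tw_hom_coeff_zero[OF SD(1)[OF A 0(1)]] by simp
    qed
    then have "f = ac_zero D A B" by auto
    then show ?case using TD(2)[OF A] by simp
  next
    case (Suc n)
    \<comment> \<open>\<open>lead\<close> is indexed by the source of the coefficient, so the object
      to use is \<open>\<Phi>^(s n) A\<close>.\<close>
    have A': "P (- (s * int n)) (P (s * int n) A) = A" using A by simp
    have "f (s * int n) \<in> lead B S n (P (s * int n) A)"
      using Suc.prems unfolding lead_def A' deg_le_def by auto
    then have "f (s * int n) \<in> lead B T n (P (s * int n) A)"
      using lead[of "P (s * int n) A" n] A by auto
    then obtain q where q: "q \<in> T A" "deg_le n A B q" "f (s * int n) = q (s * int n)"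
      by (rule leadE) (simp only: A')
    obtain z where z: "z \<in> S A" "ac_add D A B z q = f"
      using K.submodule_diff[OF S, of A f q] A q(1) TS[OF A] Suc.prems(1) by auto
    \<comment> \<open>In degree \<open>n\<close> the coefficients of \<open>f\<close> and
      \<open>q\<close> agree, and above it both vanish.\<close>
    have "z (s * int m) = ac_zero C (P (s * int m) A) B" if "n \<le> m" for m
    proof -
      have "q (s * int m) = f (s * int m)"
        using that q(2,3) Suc.prems(2) by (cases "m = n") (auto simp: deg_le_def)
      moreover have "ac_add C (P (s * int m) A) B (z (s * int m)) (q (s * int m)) = f (s * int m)"
        using z(2) by auto
      moreover have "z (s * int m) \<in> ac_hom C (P (s * int m) A) B" "q (s * int m) \<in> ac_hom C (P (s * int m) A) B"
        using tw_hom_coeff SD(1)[OF A] TD(1)[OF A] z(1) q(1) by blast+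
      ultimately show ?thesis
        using hom_group(8)[of "P (s * int m) A" B "q (s * int m)" "z (s * int m)" "ac_zero C (P (s * int m) A) B"]
          A B by simp
    qed
    then have "z \<in> T A" using Suc.IH[OF z(1)] by blast
    then show ?case using TD(3)[OF A _ q(1)] z(2) by blast
  qed
  fix f assume f: "f \<in> S A"
  have "finite ((\<lambda>i. nat (s * i)) ` tw_support C po A B f)"
    using tw_finite[OF SD(1)[OF A f]] by simp
  then obtain n where n: "\<forall>x\<in>(\<lambda>i. nat (s * i)) ` tw_support C po A B f. x < n"
    by (meson finite_nat_set_iff_bounded)
  have "f (s * int m) = ac_zero C (P (s * int m) A) B" if "n \<le> m" for m
  proof (rule not_tw_support)
    show "s * int m \<notin> tw_support C po A B f"
      using n that by (auto simp: sign_sq)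
  qed
  then show "f \<in> T A" using main[OF f] by blast
qed

section \<open>Polynomials in one direction\<close>

theorem right_noetherian_twisted_polynomials:
  assumes noeth: "right_noetherian C"
  shows "right_noetherian D"
  unfolding right_noetherian_def tw_simps(1)
proof (intro ballI allI impI)
  fix B S assume B: "B \<in> ac_obj C" and S: "submodule D (hom_module D B) S"
  interpret H: category_module C "hom_module C B"
    by unfold_locales (rule is_module_hom_module[OF B])
  interpret K: category_module D "hom_module D B" by (rule category_module_twisted[OF B])
  note lead_S = submodule_lead[OF B S]
  \<comment> \<open>Finite generation of the union makes the chain stabilise. The union is closed
    under addition because the chain ascends, so two elements occur in a common degree.\<close>
  define I where "I X = (\<Union>n. lead B S n X)" for X
  have "submodule C (hom_module C B) I"
  proof (rule H.submoduleI; unfold hom_module_simps)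
    fix X assume X: "X \<in> ac_obj C"
    note L = H.submoduleD[OF lead_S X, unfolded hom_module_simps]
    show "I X \<subseteq> ac_hom C X B" using L(1) by (auto simp: I_def)
    show "ac_zero C X B \<in> I X" using L(2) by (auto simp: I_def)
    fix x y assume "x \<in> I X" "y \<in> I X"
    then obtain m n where "x \<in> lead B S m X" "y \<in> lead B S n X" by (auto simp: I_def)
    then have "x \<in> lead B S (max m n) X" "y \<in> lead B S (max m n) X"
      using lead_mono[OF B S X max.cobounded1] lead_mono[OF B S X max.cobounded2] by blast+
    then show "ac_add C X B x y \<in> I X" using L(3) by (auto simp: I_def)
  next
    fix X Y h x assume "X \<in> ac_obj C" "Y \<in> ac_obj C" "h \<in> ac_hom C X Y" "x \<in> I Y"
    then show "ac_comp C X Y B x h \<in> I X"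
      using H.submoduleD(4)[OF lead_S, unfolded hom_module_simps] unfolding I_def by blast
  qed
  then obtain G where G': "finite G" "generates C (hom_module C B) G I"
    using noeth B unfolding right_noetherian_def fg_submodule_def by blast
  note G = G'(1) generatesD[OF G'(2)]
  have "\<forall>p\<in>G. \<exists>n. snd p \<in> lead B S n (fst p)"
    using G(3) by (force simp: I_def)
  then obtain \<nu> where \<nu>: "\<And>p. p \<in> G \<Longrightarrow> snd p \<in> lead B S (\<nu> p) (fst p)" by metis
  \<comment> \<open>Each generator \<open>p\<close> of the union occurs in degree
    \<open>\<nu> p\<close>, so the ideal in degree \<open>N\<close> contains all of them and hence
    the whole union.\<close>
  obtain N where N: "\<forall>n\<in>\<nu> ` G. n < N"
    using G(1) by (meson finite_imageI finite_nat_set_iff_bounded)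
  have I_lead: "I X \<subseteq> lead B S N X" if X: "X \<in> ac_obj C" for X
  proof (rule G(4)[OF lead_S _ X])
    fix Y x assume p: "(Y, x) \<in> G"
    then show "x \<in> lead B S N Y"
      using \<nu>[OF p] lead_mono[OF B S G(2)[OF p], of "\<nu> (Y, x)" N] N by fastforce
  qed
  have "\<exists>G. finite G \<and> generates C (hom_module C B) G (lead B S n)" for n
    using noeth B lead_S unfolding right_noetherian_def fg_submodule_def by blast
  then have "\<forall>n. \<exists>G. finite G \<and> generates C (hom_module C B) G (lead B S n)" by blast
  from choice[OF this] obtain \<Gamma> where
    \<Gamma>': "\<And>n. finite (\<Gamma> n)" "\<And>n. generates C (hom_module C B) (\<Gamma> n) (lead B S n)"
    by blast
  note \<Gamma> = \<Gamma>'(1) generatesD[OF \<Gamma>'(2)]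
  define \<phi> where "\<phi> n X x = (SOME f. f \<in> S (P (- (s * int n)) X) \<and>
      deg_le n (P (- (s * int n)) X) B f \<and> x = f (s * int n))" for n X x
  have \<phi>: "\<phi> n X x \<in> S (P (- (s * int n)) X) \<and> deg_le n (P (- (s * int n)) X) B (\<phi> n X x) \<and>
      x = \<phi> n X x (s * int n)" if "(X, x) \<in> \<Gamma> n" for n X x
  proof -
    have "\<exists>f. f \<in> S (P (- (s * int n)) X) \<and> deg_le n (P (- (s * int n)) X) B f \<and> x = f (s * int n)"
      using \<Gamma>(3)[OF that] unfolding lead_def by blast
    from someI_ex[OF this] show ?thesis unfolding \<phi>_def .
  qed
  \<comment> \<open>Polynomials realising the generators of the leading coefficient ideals. Stopping
    at degree \<open>N\<close> keeps the set finite.\<close>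
  define K where "K = (\<Union>n\<le>N. (\<lambda>(X, x). (P (- (s * int n)) X, \<phi> n X x)) ` \<Gamma> n)"
  have "generates D (hom_module D B) K S"
  proof (rule generatesI)
    fix A f assume "(A, f) \<in> K"
    then show "A \<in> ac_obj D" "f \<in> S A"
      using \<Gamma>(2) \<phi> by (auto simp: K_def)
  next
    fix T A assume T: "submodule D (hom_module D B) T"
      and K: "\<And>A f. (A, f) \<in> K \<Longrightarrow> f \<in> T A" and A: "A \<in> ac_obj D"
    \<comment> \<open>The comparison through leading coefficients requires a submodule contained in
      \<open>S\<close>.\<close>
    let ?T = "\<lambda>A. T A \<inter> S A"
    have T': "submodule D (hom_module D B) ?T" using K.submodule_Int[OF T S] .
    have low: "lead B S n X \<subseteq> lead B ?T n X" if X: "X \<in> ac_obj C" and n: "n \<le> N" for n X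
    proof (rule \<Gamma>(4)[OF submodule_lead[OF B T'] _ X])
      fix Y x assume p: "(Y, x) \<in> \<Gamma> n"
      then have "(P (- (s * int n)) Y, \<phi> n Y x) \<in> K"
        using n unfolding K_def by force
      then show "x \<in> lead B ?T n Y"
        using \<phi>[OF p] K by (intro leadI[where f = "\<phi> n Y x"]) auto
    qed
    have "lead B S n X \<subseteq> lead B ?T n X" if X: "X \<in> ac_obj C" for n X
    proof (cases "n \<le> N")
      case False
      \<comment> \<open>Beyond \<open>N\<close> the ideals of \<open>S\<close> no longer grow, while
        those of \<open>?T\<close> contain what they had in degree \<open>N\<close>.\<close>
      have "lead B S n X \<subseteq> I X" by (auto simp: I_def)
      also have "\<dots> \<subseteq> lead B S N X" by (rule I_lead[OF X])
      also have "\<dots> \<subseteq> lead B ?T N X" by (rule low[OF X]) simp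
      also have "\<dots> \<subseteq> lead B ?T n X" using False by (intro lead_mono[OF B T' X]) simp
      finally show ?thesis .
    qed (rule low[OF X])
    then have "S A \<subseteq> ?T A"
      using A by (intro ideal_subset_of_lead_subset[OF B S T']) auto
    then show "S A \<subseteq> T A" by blast
  qed
  moreover have "finite K" unfolding K_def using \<Gamma>(1) by blast
  ultimately show "fg_submodule D (hom_module D B) S"
    unfolding fg_submodule_def by blast
qed

end

section \<open>From polynomials to Laurent polynomials\<close>

theorem right_noetherian_twisted_laurent:
  assumes "preadditive C" "additive_automorphism C po pm"
    and noeth: "right_noetherian (twisted C po pm (\<lambda>i. 0 \<le> i))"
  shows "right_noetherian (twisted C po pm (\<lambda>_. True))"
proof -
  interpret preadditive C by fact
  interpret pol: twisted_category C po pm "\<lambda>i. 0 \<le> i"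
    by (intro twisted_category.intro twisted_category_axioms.intro assms(1,2)) simp_all
  interpret lau: twisted_category C po pm "\<lambda>_. True"
    by (intro twisted_category.intro twisted_category_axioms.intro assms(1,2)) simp_all
  let ?P = "pow_obj C po"
  let ?D = "twisted C po pm (\<lambda>i. 0 \<le> i)" and ?L = "twisted C po pm (\<lambda>_. True)"
  \<comment> \<open>Composition is given by one formula in both categories; only the sets of
    morphisms differ.\<close>
  have comp: "ac_comp ?D = ac_comp ?L" by (simp only: twisted_def addcat.select_convs)
  have hom: "f \<in> ac_hom ?D A B \<longleftrightarrow> f \<in> ac_hom ?L A B \<and> (\<forall>i<0. f i = ac_zero C (?P i A) B)" for f A B
    unfolding pol.tw_hom lau.tw_hom by (auto simp: not_le)
  show ?thesis
    unfolding right_noetherian_def tw_simps(1)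
  proof (intro ballI allI impI)
    fix B S assume B: "B \<in> ac_obj C" and S: "submodule ?L (hom_module ?L B) S"
    interpret K: category_module ?D "hom_module ?D B" by (rule pol.category_module_twisted[OF B])
    interpret L: category_module ?L "hom_module ?L B" by (rule lau.category_module_twisted[OF B])
    \<comment> \<open>Applied to \<open>S\<close> to obtain generators, and to every test submodule
      \<open>T\<close> to compare with them.\<close>
    have sub: "submodule ?D (hom_module ?D B) (\<lambda>A. T A \<inter> ac_hom ?D A B)"
      if T: "submodule ?L (hom_module ?L B) T" for T
    proof (rule K.submoduleI; unfold hom_module_simps tw_simps(1))
      note T = L.submoduleD[OF T, unfolded hom_module_simps tw_simps(1)]
      fix A assume A: "A \<in> ac_obj C"
      show "ac_zero ?D A B \<in> T A \<inter> ac_hom ?D A B"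
        using T(2)[OF A] pol.tw_zero_closed[OF A B] by simp
      show "ac_add ?D A B f g \<in> T A \<inter> ac_hom ?D A B"
        if "f \<in> T A \<inter> ac_hom ?D A B" "g \<in> T A \<inter> ac_hom ?D A B" for f g
        using that T(3)[OF A, of f g] pol.tw_add_closed[OF A B, of f g] by simp
    next
      note T = L.submoduleD[OF T, unfolded hom_module_simps tw_simps(1)]
      fix A A' h f assume A: "A \<in> ac_obj C" "A' \<in> ac_obj C" and h: "h \<in> ac_hom ?D A A'"
        and f: "f \<in> T A' \<inter> ac_hom ?D A' B"
      have "h \<in> ac_hom ?L A A'" using h hom by blast
      then show "ac_comp ?D A A' B f h \<in> T A \<inter> ac_hom ?D A B"
        using pol.tw_comp_closed[OF A B h] T(4)[OF A] f unfolding comp by blast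
    qed auto
    have "fg_submodule ?D (hom_module ?D B) (\<lambda>A. S A \<inter> ac_hom ?D A B)"
      using noeth B sub[OF S] unfolding right_noetherian_def by simp
    then obtain G where G': "finite G" "generates ?D (hom_module ?D B) G (\<lambda>A. S A \<inter> ac_hom ?D A B)"
      unfolding fg_submodule_def by blast
    note G = G'(1) generatesD[OF G'(2), unfolded tw_simps(1)]
    have "generates ?L (hom_module ?L B) G S"
    proof (rule generatesI)
      show "A \<in> ac_obj ?L" "x \<in> S A" if "(A, x) \<in> G" for A x
        using G(2,3)[OF that] by auto
      fix T A assume T: "submodule ?L (hom_module ?L B) T"
        and gens: "\<And>A x. (A, x) \<in> G \<Longrightarrow> x \<in> T A" and "A \<in> ac_obj ?L"
      then have A: "A \<in> ac_obj C" by simp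
      note SD = L.submoduleD[OF S, unfolded hom_module_simps tw_simps(1)]
      note TD = L.submoduleD[OF T, unfolded hom_module_simps tw_simps(1)]
      have pol_sub: "S A \<inter> ac_hom ?D A B \<subseteq> T A" if A: "A \<in> ac_obj C" for A
      proof -
        have "x \<in> T A' \<inter> ac_hom ?D A' B" if "(A', x) \<in> G" for A' x
          using gens[OF that] G(3)[OF that] by blast
        from G(4)[OF sub[OF T] this A] show ?thesis by blast
      qed
      show "S A \<subseteq> T A"
      proof
        fix f assume f: "f \<in> S A"
        then have fhom: "f \<in> ac_hom ?L A B" by (rule SD(1)[OF A])
        have "finite ((\<lambda>i. nat (- i)) ` tw_support C po A B f)"
          using lau.tw_finite[OF fhom] by simp
        \<comment> \<open>\<open>- n\<close> lies strictly below every exponent occurring in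
          \<open>f\<close>.\<close>
        then obtain n where n: "\<forall>x\<in>(\<lambda>i. nat (- i)) ` tw_support C po A B f. x < n"
          by (meson finite_nat_set_iff_bounded)
        have zero: "f i = ac_zero C (?P i A) B" if "i < - int n" for i
          using n that by (intro lau.not_tw_support) force
        let ?A = "?P (- int n) A"
        have A': "?A \<in> ac_obj C" using A by simp
        have t: "lau.t_power (int n) A \<in> ac_hom ?L ?A A" using A by simp
        let ?g = "ac_comp ?L ?A A B f (lau.t_power (int n) A)"
        have g: "?g k = f (k - int n)" for k
          using lau.comp_t_power[OF A B fhom, of "int n" k] by simp
        have gS: "?g \<in> S ?A" using SD(4)[OF A' A t f] .
        have ghom: "?g \<in> ac_hom ?L ?A B" using SD(1)[OF A' gS] .
        have "?g \<in> ac_hom ?D ?A B"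
          unfolding hom using ghom zero A by (simp add: g)
        then have gT: "?g \<in> T ?A" using pol_sub[OF A'] gS by blast
        have AA: "?P (- (- int n)) ?A = A" using A by simp
        \<comment> \<open>Multiplying back by \<open>t^(-n)\<close> restores \<open>f\<close>. This
          is a morphism of the Laurent category, so it matters that \<open>T\<close> is closed under
          the larger action.\<close>
        have t': "lau.t_power (- int n) ?A \<in> ac_hom ?L A ?A"
          using lau.t_power_closed[OF A', of "- int n"] unfolding AA by simp
        have "ac_comp ?L A ?A B ?g (lau.t_power (- int n) ?A) k = f k" for k
          using lau.comp_t_power[OF A' B ghom, of "- int n" k] unfolding AA g by simp
        then have "ac_comp ?L A ?A B ?g (lau.t_power (- int n) ?A) = f" by (rule ext)
        then show "f \<in> T A" using TD(4)[OF A A' t' gT] by simp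
      qed
    qed
    then show "fg_submodule ?L (hom_module ?L B) S"
      using G'(1) unfolding fg_submodule_def by blast
  qed
qed

section \<open>Both statements, for an arbitrary type of module elements\<close>

theorem mainTheorem14:
  fixes C :: "('o, 'f) addcat"
    and po :: "'o \<Rightarrow> 'o"
    and pm :: "'o \<Rightarrow> 'o \<Rightarrow> 'f \<Rightarrow> 'f"
  assumes "additive_category C"
    and "additive_automorphism C po pm"
  shows "(noetherian C TYPE('f list set) \<longrightarrow>
            noetherian (twisted C po pm (\<lambda>i. 0 \<le> i)) TYPE('m) \<and>
            noetherian (twisted C po pm (\<lambda>i. i \<le> 0)) TYPE('m) \<and>
            noetherian (twisted C po pm (\<lambda>_. True)) TYPE('m))
       \<and> (noetherian (twisted C po pm (\<lambda>i. 0 \<le> i)) TYPE((int \<Rightarrow> 'f) list set) \<longrightarrow>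
            noetherian (twisted C po pm (\<lambda>_. True)) TYPE('m))"
proof -
  have C: "preadditive C"
    using assms(1) by unfold_locales (simp add: additive_category_def)
  interpret preadditive C by fact
  interpret lau: twisted_category C po pm "\<lambda>_. True"
    using assms(2) by unfold_locales auto
  interpret pos: twisted_polynomials C po pm 1
    using assms(2) by unfold_locales auto
  interpret neg: twisted_polynomials C po pm "- 1"
    using assms(2) by unfold_locales auto
  have sgn: "twisted C po pm (\<lambda>i. 0 \<le> 1 * i) = twisted C po pm (\<lambda>i. 0 \<le> i)"
    "twisted C po pm (\<lambda>i. 0 \<le> - 1 * i) = twisted C po pm (\<lambda>i. i \<le> 0)"
    by simp_all
  note preadd = pos.preadditive_twisted[unfolded sgn] neg.preadditive_twisted[unfolded sgn]
  \<comment> \<open>A finitely generated module is a quotient of a sum of representables, so its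
    elements can be modelled by cosets, that is, by sets of lists of morphisms. Morphisms embed into
    this type as singletons of one-element lists.\<close>
  have inj: "inj (\<lambda>f. {[f]})" by (auto intro: injI)
  \<comment> \<open>Shared by both statements: the first reaches it through the polynomial case, the
    second starts from its hypothesis.\<close>
  have laurent: "noetherian (twisted C po pm (\<lambda>_. True)) TYPE('m)"
    if "right_noetherian (twisted C po pm (\<lambda>i. 0 \<le> i))"
    using preadditive.noetherian_of_right_noetherian[OF lau.preadditive_twisted]
      right_noetherian_twisted_laurent[OF C assms(2) that] .
  show ?thesis
  proof (intro conjI impI)
    assume "noetherian C TYPE('f list set)"
    then have C': "right_noetherian C"
      using inj by (rule right_noetherian_of_noetherian)
    note noeth = pos.right_noetherian_twisted_polynomials[OF C', unfolded sgn]
      neg.right_noetherian_twisted_polynomials[OF C', unfolded sgn]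
    show "noetherian (twisted C po pm (\<lambda>i. 0 \<le> i)) TYPE('m)"
      using preadditive.noetherian_of_right_noetherian[OF preadd(1) noeth(1)] .
    show "noetherian (twisted C po pm (\<lambda>i. i \<le> 0)) TYPE('m)"
      using preadditive.noetherian_of_right_noetherian[OF preadd(2) noeth(2)] .
    show "noetherian (twisted C po pm (\<lambda>_. True)) TYPE('m)"
      using laurent noeth(1) .
  next
    assume "noetherian (twisted C po pm (\<lambda>i. 0 \<le> i)) TYPE((int \<Rightarrow> 'f) list set)"
    then have "right_noetherian (twisted C po pm (\<lambda>i. 0 \<le> i))"
      using inj by (rule preadditive.right_noetherian_of_noetherian[OF preadd(1)])
    then show "noetherian (twisted C po pm (\<lambda>_. True)) TYPE('m)" by (rule laurent)
  qed
qed

end
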